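(* Let $\ell,k,d\in\mathbb{Z}_{>0}$ with $k\mid\ell$. Let $\Phi:\mathbb{C}[S(\ell,d)]\to A_{(\ell,d)}$ be the algebra isomorphism and $\Psi:A_{(\ell,k,d)}\to A_{(\ell,d)}$ the injective algebra homomorphism described in the context. Then the image of $\Phi^{-1}\Psi$ coincides with the subalgebra $\mathbb{C}[G(\ell,k,d)]$ of $\mathbb{C}[S(\ell,d)]$. In particular, the algebras $A_{(\ell,k,d)}$ and $\mathbb{C}[G(\ell,k,d)]$ are isomorphic.
   Context: Write $\underline{n}=\{1,\dots,n\}$. $\mathbf{C}_r$ is the group of complex $r$-th roots of unity; $\xi_\ell$ is a fixed generator of $\mathbf{C}_\ell$. $S(\ell,d)=\mathbf{C}_\ell\wr S_d$ is the group of complex $d\times d$ matrices with exactly one non-zero entry in each row and column, all non-zero entries lying in $\mathbf{C}_\ell$. It is generated by $S_d$ (permutation matrices, $\sigma$ sending $\epsilon_j$ to $\epsilon_{\sigma(j)}$) and the diagonal matrix $s_0$ with $(1,1)$-entry $\xi_\ell$ and other diagonal entries $1$. The complex reflection group $G(\ell,k,d)$ is the index $k$ subgroup of $S(\ell,d)$ of all matrices for which the product of the non-zero entries lies in $\mathbf{C}_{\ell/k}$. The groupoid $\mathcal{G}_{(\ell,d)}$: objects are all maps $f:\underline{d}\to\underline{\ell}$; morphisms from $f$ to $g$ are all bijections $\sigma:\underline{d}\to\underline{d}$ with $g\circ\sigma=f$; composition is composition of maps; $e_f$ is the identity of $f$. $A_{(\ell,d)}$ is the algebra with basis all morphisms of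 $\mathcal{G}_{(\ell,d)}$, product being composition if defined and $0$ otherwise. $\Phi$ is the algebra isomorphism $\mathbb{C}[S(\ell,d)]\to A_{(\ell,d)}$ determined by $\Phi(\sigma)=\sum_{f,g}\sigma_{(f,g)}$ for $\sigma\in S_d$ and $\Phi(s_0)=\sum_f\xi_\ell^{f(1)}e_f$, where $\sigma_{(f,g)}$ is $\sigma$ viewed as a morphism $f\to g$ if $g\circ\sigma=f$, and $0$ otherwise. Let $\theta$ be the cyclic permutation $1\mapsto 2\mapsto\dots\mapsto\ell\mapsto 1$ of $\underline{\ell}$, $\theta_k=\theta^{\ell/k}$ and $H_k=\langle\theta_k\rangle$ (of order $k$). $H_k$ acts by automorphisms on $\mathcal{G}_{(\ell,d)}$: $h$ sends an object $f$ to $h\circ f$ and a morphism $\sigma:f\to g$ to the same bijection $\sigma$ viewed as a morphism $h\circ f\to h\circ g$. This action is free. The quotient groupoid $\mathcal{G}^k_{(\ell,d)}=\mathcal{G}_{(\ell,d)}/H_k$ has as objects the $H_k$-orbits $f^{(k)}$ of objects and as morphisms $f^{(k)}\to g^{(k)}$ the $H_k$-orbits $\sigma^{(k)}$ on $\coprod_{f'\in f^{(k)},g'\in g^{(k)}}\mathcal{G}_{(\ell,d)}(f',g')$; composition is induced from $\mathcal{G}_{(\ell,d)}$ (compose composable representatives). $A_{(\ell,k,d)}$ is the algebra with basis all morphisms of $\mathcal{G}^k_{(\ell,d)}$, product being composition if defined and $0$ otherwise. $\Psi$ is the injective algebra homomorphism sending each basis element $\sigma^{(k)}$ to the sum $\sum_{\tau\in\sigma^{(k)}}\tau$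 of all morphisms in the orbit. *)

theory Defs
  imports
    "HOL-Library.FuncSet"
    "HOL-Algebra.Module"
    "HOL-Algebra.Generated_Groups"
    "HOL-Algebra.Sym_Groups"
    "Jordan_Normal_Form.Matrix"
begin

section \<open>Complex algebras with a finite multiplicative basis\<close>

text \<open>The library locale \<open>algebra\<close> requires a commutative multiplication, so only its record type
  is used. Elements are coefficient functions vanishing outside the finite basis \<open>B\<close>; the product
  of two basis elements is given by \<open>P\<close>, where \<open>None\<close> stands for the product \<open>0\<close>, and the unit is
  the sum of the basis elements in \<open>U\<close>.\<close>

definition basis_algebra ::
    "'b set \<Rightarrow> ('b \<Rightarrow> 'b \<Rightarrow> 'b option) \<Rightarrow> 'b set \<Rightarrow> (complex, 'b \<Rightarrow> complex) module" where
  "basis_algebra B P U =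
    \<lparr> carrier = {a. \<forall>x. x \<notin> B \<longrightarrow> a x = 0},
      mult = (\<lambda>a b x. \<Sum>(p, q) \<in> {(p, q). p \<in> B \<and> q \<in> B \<and> P p q = Some x}. a p * b q),
      one = (\<lambda>x. if x \<in> U then 1 else 0),
      zero = (\<lambda>x. 0),
      add = (\<lambda>a b x. a x + b x),
      smult = (\<lambda>c a x. c * a x) \<rparr>"

definition basis_elt :: "'b \<Rightarrow> 'b \<Rightarrow> complex" where
  "basis_elt b = (\<lambda>x. if x = b then 1 else 0)"

definition algebra_hom ::
    "(complex, 'a) module \<Rightarrow> (complex, 'b) module \<Rightarrow> ('a \<Rightarrow> 'b) set" where
  "algebra_hom A B = {h \<in> ring_hom A B. \<forall>c. \<forall>a \<in> carrier A. h (c \<odot>\<^bsub>A\<^esub> a) = c \<odot>\<^bsub>B\<^esub> h a}"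

definition algebra_iso ::
    "(complex, 'a) module \<Rightarrow> (complex, 'b) module \<Rightarrow> ('a \<Rightarrow> 'b) set" where
  "algebra_iso A B = {h \<in> algebra_hom A B. bij_betw h (carrier A) (carrier B)}"

definition algebras_isomorphic ::
    "(complex, 'a) module \<Rightarrow> (complex, 'b) module \<Rightarrow> bool" where
  "algebras_isomorphic A B \<longleftrightarrow> algebra_iso A B \<noteq> {}"

definition group_algebra :: "'g monoid \<Rightarrow> (complex, 'g \<Rightarrow> complex) module" where
  "group_algebra G = basis_algebra (carrier G) (\<lambda>x y. Some (x \<otimes>\<^bsub>G\<^esub> y)) {\<one>\<^bsub>G\<^esub>}"

record ('o, 'm) groupoid =
  Obj :: "'o set"
  Mor :: "'m set"
  Src :: "'m \<Rightarrow> 'o"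
  Tgt :: "'m \<Rightarrow> 'o"
  Cmp :: "'m \<Rightarrow> 'm \<Rightarrow> 'm"  \<comment> \<open>\<open>Cmp \<tau> \<sigma>\<close> is \<open>\<tau>\<close> after \<open>\<sigma>\<close>, for \<open>Src \<tau> = Tgt \<sigma>\<close>\<close>
  Idm :: "'o \<Rightarrow> 'm"

definition groupoid_algebra :: "('o, 'm) groupoid \<Rightarrow> (complex, 'm \<Rightarrow> complex) module" where
  "groupoid_algebra C =
    basis_algebra (Mor C) (\<lambda>q p. if Src C q = Tgt C p then Some (Cmp C q p) else None)
      (Idm C ` Obj C)"


section \<open>Complex reflection groups\<close>

definition roots_of_1 :: "nat \<Rightarrow> complex set" where
  "roots_of_1 r = {z. z ^ r = 1}"

definition is_generator_of_roots :: "nat \<Rightarrow> complex \<Rightarrow> bool" where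
  "is_generator_of_roots l xi \<longleftrightarrow> roots_of_1 l = {xi ^ n | n :: nat. True}"

text \<open>Matrices are indexed from \<open>0\<close>: the mathematical entry \<open>(i, j)\<close> with
  \<open>1 \<le> i, j \<le> d\<close> is \<open>M $$ (i - 1, j - 1)\<close>.\<close>

definition S_group :: "nat \<Rightarrow> nat \<Rightarrow> complex mat monoid" where
  "S_group l d =
    \<lparr> carrier = {M \<in> carrier_mat d d.
        (\<forall>i<d. \<exists>!j. j < d \<and> M $$ (i, j) \<noteq> 0) \<and>
        (\<forall>j<d. \<exists>!i. i < d \<and> M $$ (i, j) \<noteq> 0) \<and>
        (\<forall>i<d. \<forall>j<d. M $$ (i, j) \<noteq> 0 \<longrightarrow> M $$ (i, j) \<in> roots_of_1 l)},
      mult = (*),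
      one = 1\<^sub>m d \<rparr>"

definition nonzero_entries_prod :: "nat \<Rightarrow> complex mat \<Rightarrow> complex" where
  "nonzero_entries_prod d M =
    (\<Prod>(i, j) \<in> {(i, j). i < d \<and> j < d \<and> M $$ (i, j) \<noteq> 0}. M $$ (i, j))"

text \<open>As \<open>G(l, k, d)\<close> shares its operations with \<open>S(l, d)\<close>, its group algebra is literally the
  set of those elements of the group algebra of \<open>S(l, d)\<close> that are supported on \<open>G(l, k, d)\<close>.\<close>

definition G_group :: "nat \<Rightarrow> nat \<Rightarrow> nat \<Rightarrow> complex mat monoid" where
  "G_group l k d = (S_group l d)
    \<lparr> carrier :=
        {M \<in> carrier (S_group l d). nonzero_entries_prod d M \<in> roots_of_1 (l div k)} \<rparr>"

definition perm_matrix :: "nat \<Rightarrow> (nat \<Rightarrow> nat) \<Rightarrow> complex mat" where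
  "perm_matrix d \<sigma> = mat d d (\<lambda>(i, j). if Suc i = \<sigma> (Suc j) then 1 else 0)"

definition s0_matrix :: "nat \<Rightarrow> complex \<Rightarrow> complex mat" where
  "s0_matrix d xi = mat d d (\<lambda>(i, j). if i = j then (if i = 0 then xi else 1) else 0)"


section \<open>The groupoid and its quotient\<close>

type_synonym obj = "nat \<Rightarrow> nat"
type_synonym mor = "obj \<times> (nat \<Rightarrow> nat) \<times> obj"

text \<open>A morphism is a triple (source, bijection, target). Bijections of \<open>{1..d}\<close> are extended by the
  identity and objects by \<open>undefined\<close>, so that \<open>g \<circ> \<sigma>\<close> is again extensional.\<close>

definition G_objs :: "nat \<Rightarrow> nat \<Rightarrow> obj set" where
  "G_objs l d = {1..d} \<rightarrow>\<^sub>E {1..l}"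

definition G_groupoid :: "nat \<Rightarrow> nat \<Rightarrow> (obj, mor) groupoid" where
  "G_groupoid l d =
    \<lparr> Obj = G_objs l d,
      Mor = {(f, \<sigma>, g). f \<in> G_objs l d \<and> g \<in> G_objs l d \<and> \<sigma> permutes {1..d} \<and> g \<circ> \<sigma> = f},
      Src = (\<lambda>(f, \<sigma>, g). f),
      Tgt = (\<lambda>(f, \<sigma>, g). g),
      Cmp = (\<lambda>(f', \<tau>, g') (f, \<sigma>, g). (f, \<tau> \<circ> \<sigma>, g')),
      Idm = (\<lambda>f. (f, id, f)) \<rparr>"

definition theta :: "nat \<Rightarrow> nat \<Rightarrow> nat" where
  "theta l = (\<lambda>i. if 1 \<le> i \<and> i < l then i + 1 else if i = l then 1 else i)"

definition H_group :: "nat \<Rightarrow> nat \<Rightarrow> (nat \<Rightarrow> nat) set" where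
  "H_group l k = generate (sym_group l) {theta l ^^ (l div k)}"

definition act_obj :: "nat \<Rightarrow> (nat \<Rightarrow> nat) \<Rightarrow> obj \<Rightarrow> obj" where
  "act_obj d h f = compose {1..d} h f"

definition act_mor :: "nat \<Rightarrow> (nat \<Rightarrow> nat) \<Rightarrow> mor \<Rightarrow> mor" where
  "act_mor d h = (\<lambda>(f, \<sigma>, g). (act_obj d h f, \<sigma>, act_obj d h g))"

definition orbit_obj :: "nat \<Rightarrow> nat \<Rightarrow> nat \<Rightarrow> obj \<Rightarrow> obj set" where
  "orbit_obj l k d f = (\<lambda>h. act_obj d h f) ` H_group l k"

definition orbit_mor :: "nat \<Rightarrow> nat \<Rightarrow> nat \<Rightarrow> mor \<Rightarrow> mor set" where
  "orbit_mor l k d m = (\<lambda>h. act_mor d h m) ` H_group l k"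

text \<open>Source, target and identities are taken elementwise, which again yields orbits because the
  action is by automorphisms. The composite is unique because the action is free.\<close>

definition quotient_groupoid :: "nat \<Rightarrow> nat \<Rightarrow> nat \<Rightarrow> (obj set, mor set) groupoid" where
  "quotient_groupoid l k d = (let C = G_groupoid l d in
    \<lparr> Obj = orbit_obj l k d ` Obj C,
      Mor = orbit_mor l k d ` Mor C,
      Src = (\<lambda>S. Src C ` S),
      Tgt = (\<lambda>S. Tgt C ` S),
      Cmp = (\<lambda>T S. THE R. \<exists>\<tau>\<in>T. \<exists>\<sigma>\<in>S. Src C \<tau> = Tgt C \<sigma> \<and> R = orbit_mor l k d (Cmp C \<tau> \<sigma>)),
      Idm = (\<lambda>F. Idm C ` F) \<rparr>)"


section \<open>The algebras and the maps\<close>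

definition A_alg :: "nat \<Rightarrow> nat \<Rightarrow> (complex, mor \<Rightarrow> complex) module" where
  "A_alg l d = groupoid_algebra (G_groupoid l d)"

definition A_quot_alg :: "nat \<Rightarrow> nat \<Rightarrow> nat \<Rightarrow> (complex, mor set \<Rightarrow> complex) module" where
  "A_quot_alg l k d = groupoid_algebra (quotient_groupoid l k d)"

definition perm_arrow :: "(nat \<Rightarrow> nat) \<Rightarrow> obj \<Rightarrow> obj \<Rightarrow> mor \<Rightarrow> complex" where
  "perm_arrow \<sigma> f g = (if g \<circ> \<sigma> = f then basis_elt (f, \<sigma>, g) else (\<lambda>_. 0))"

definition is_Phi ::
    "nat \<Rightarrow> nat \<Rightarrow> complex \<Rightarrow> ((complex mat \<Rightarrow> complex) \<Rightarrow> (mor \<Rightarrow> complex)) \<Rightarrow> bool" where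
  "is_Phi l d xi \<phi> \<longleftrightarrow>
    \<phi> \<in> algebra_iso (group_algebra (S_group l d)) (A_alg l d) \<and>
    \<phi> \<in> extensional (carrier (group_algebra (S_group l d))) \<and>
    (\<forall>\<sigma>. \<sigma> permutes {1..d} \<longrightarrow>
      \<phi> (basis_elt (perm_matrix d \<sigma>)) =
        (\<lambda>m. \<Sum>f\<in>G_objs l d. \<Sum>g\<in>G_objs l d. perm_arrow \<sigma> f g m)) \<and>
    \<phi> (basis_elt (s0_matrix d xi)) =
      (\<lambda>m. \<Sum>f\<in>G_objs l d. xi ^ f 1 * basis_elt (Idm (G_groupoid l d) f) m)"

text \<open>Such a map is unique: the permutation matrices together with the matrix \<open>s0\<close> generate
  \<open>S(l, d)\<close>, and extensionality fixes the values outside the group algebra.\<close>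

definition Phi ::
    "nat \<Rightarrow> nat \<Rightarrow> complex \<Rightarrow> (complex mat \<Rightarrow> complex) \<Rightarrow> (mor \<Rightarrow> complex)" where
  "Phi l d xi = (THE \<phi>. is_Phi l d xi \<phi>)"

definition Psi ::
    "nat \<Rightarrow> nat \<Rightarrow> nat \<Rightarrow> (mor set \<Rightarrow> complex) \<Rightarrow> (mor \<Rightarrow> complex)" where
  "Psi l k d a =
    (\<lambda>m. \<Sum>S\<in>Mor (quotient_groupoid l k d). a S * (\<Sum>\<tau>\<in>S. basis_elt \<tau> m))"

end

theory Submission
  imports Defs
begin

text \<open>A monomial matrix with entries \<open>a j\<close> and permutation \<open>\<sigma>\<close> is sent by \<open>\<Phi>\<close> to the sum over all
  objects \<open>f\<close> of the arrows \<open>\<sigma>\<close> with source \<open>f\<close>, weighted by \<open>\<Prod>j. a j ^ f j\<close>. Writing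
  \<open>a j = \<xi> ^ c j\<close> makes this a Fourier transform on \<open>(\<int>/l)^d\<close> for each \<open>\<sigma>\<close>, hence bijective.
  Shifting \<open>f\<close> by \<open>l/k\<close> multiplies the weight by \<open>(\<Prod>j. a j) ^ (l/k)\<close>, so \<open>\<Phi> a\<close> is
  \<open>H\<close>-invariant iff \<open>a\<close> is supported on matrices with \<open>(\<Prod>j. a j) ^ (l/k) = 1\<close>, i.e. on
  \<open>G(l,k,d)\<close>; and the \<open>H\<close>-invariants are exactly the image of \<open>\<Psi>\<close>. Because the action is free,
  a factorization of an orbit in the quotient lifts uniquely to one of a given representative, which makes
  \<open>\<Psi>\<close> multiplicative.\<close>

section \<open>Monomial matrices\<close>

text \<open>The weight is forced by the prescribed values of \<open>Phi\<close>. Conjugating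
  \<open>s0_matrix\<close> by the transposition of 1 and i gives the diagonal matrix with
  \<open>xi\<close> in place i, which must act on the identity of \<open>f\<close> by
  \<open>xi ^ f i\<close>; products of such matrices with permutation matrices exhaust the group.
  Since \<open>Phi\<close> is given only as the unique isomorphism with these values, the explicit
  transform has to be shown both to be such an isomorphism and to coincide with every candidate.
  Exponents of \<open>xi\<close> and values of objects are both taken from \<open>{1..l}\<close>.
  One index set then describes the matrices and the morphisms with a given permutation, the kernel
  of the transform is symmetric, and a single orthogonality relation yields both inversion
  formulas.\<close>

definition mono_mat :: "nat \<Rightarrow> (nat \<Rightarrow> nat) \<Rightarrow> (nat \<Rightarrow> complex) \<Rightarrow> complex mat" where
  "mono_mat d \<sigma> a = mat d d (\<lambda>(i, j). if Suc i = \<sigma> (Suc j) then a (Suc j) else 0)"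

lemma mono_mat_carrier [simp]: "mono_mat d \<sigma> a \<in> carrier_mat d d"
  by (simp add: mono_mat_def)

lemma mono_mat_cong:
  assumes "\<And>j. j \<in> {1..d} \<Longrightarrow> a j = b j"
  shows "mono_mat d \<sigma> a = mono_mat d \<sigma> b"
  using assms by (intro eq_matI) (auto simp: mono_mat_def)

lemma mono_mat_entry:
  assumes "\<sigma> permutes {1..d}" and "j \<in> {1..d}" and "i \<in> {1..d}"
  shows "mono_mat d \<sigma> a $$ (i - 1, j - 1) = (if i = \<sigma> j then a j else 0)"
  using assms by (auto simp: mono_mat_def)

lemma perm_matrix_eq_mono_mat: "perm_matrix d \<sigma> = mono_mat d \<sigma> (\<lambda>_. 1)"
  by (simp add: perm_matrix_def mono_mat_def)

lemma s0_matrix_eq_mono_mat: "s0_matrix d x = mono_mat d id (\<lambda>j. if j = 1 then x else 1)"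
  by (intro eq_matI) (auto simp: s0_matrix_def mono_mat_def)

lemma one_mat_eq_mono_mat: "1\<^sub>m d = mono_mat d id (\<lambda>_. 1)"
  by (intro eq_matI) (auto simp: mono_mat_def)

text \<open>A monomial matrix sends the j-th basis vector to \<open>a j\<close> times the
  \<open>\<sigma> j\<close>-th one. The right factor acts first, so the left one contributes its
  entry at \<open>\<tau> j\<close>.\<close>

lemma mono_mat_mult:
  assumes \<tau>: "\<tau> permutes {1..d}"
  shows "mono_mat d \<sigma> a * mono_mat d \<tau> b = mono_mat d (\<sigma> \<circ> \<tau>) (\<lambda>j. a (\<tau> j) * b j)"
proof (rule eq_matI, goal_cases)
  case (1 i j)
  then have ij: "i < d" "j < d" by (auto simp: mono_mat_def)
  \<comment> \<open>The only index whose summand can survive, moved from \<open>{1..d}\<close> to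
    the matrix indices that start at 0.\<close>
  define t where "t = \<tau> (Suc j) - 1"
  have "\<tau> (Suc j) \<in> {1..d}"
    using \<tau> ij permutes_in_image[OF \<tau>, of "Suc j"] by auto
  then have t: "t < d" "\<tau> (Suc j) = Suc t" by (auto simp: t_def)
  have "(mono_mat d \<sigma> a * mono_mat d \<tau> b) $$ (i, j) =
      (\<Sum>u\<in>{0..<d}. (if Suc i = \<sigma> (Suc u) then a (Suc u) else 0) *
        (if Suc u = \<tau> (Suc j) then b (Suc j) else 0))"
    using ij by (simp add: mono_mat_def scalar_prod_def)
  also have "\<dots> = (\<Sum>u\<in>{0..<d}. if u = t then (if Suc i = \<sigma> (Suc t) then a (Suc t) * b (Suc j) else 0) else 0)"
    by (rule sum.cong) (auto simp: t)
  also have "\<dots> = mono_mat d (\<sigma> \<circ> \<tau>) (\<lambda>j. a (\<tau> j) * b j) $$ (i, j)"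
    using ij t by (simp add: mono_mat_def)
  finally show ?case .
qed (auto simp: mono_mat_def)

text \<open>In row \<open>\<sigma> j\<close> of column \<open>j\<close> the left side has the
  non-zero entry \<open>a j\<close>, which forces \<open>\<tau> j = \<sigma> j\<close> and then
  equality of the entries.\<close>

lemma mono_mat_eq_iff:
  assumes "\<sigma> permutes {1..d}" "\<tau> permutes {1..d}" "\<And>j. j \<in> {1..d} \<Longrightarrow> a j \<noteq> 0"
  shows "mono_mat d \<sigma> a = mono_mat d \<tau> b \<longleftrightarrow> \<sigma> = \<tau> \<and> (\<forall>j\<in>{1..d}. a j = b j)"
proof
  assume eq: "mono_mat d \<sigma> a = mono_mat d \<tau> b"
  have *: "\<sigma> j = \<tau> j \<and> a j = b j" if j: "j \<in> {1..d}" for j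
  proof -
    have "\<sigma> j \<in> {1..d}" using j permutes_in_image[OF assms(1)] by blast
    then have "mono_mat d \<sigma> a $$ (\<sigma> j - 1, j - 1) = a j" "mono_mat d \<tau> b $$ (\<sigma> j - 1, j - 1) = (if \<sigma> j = \<tau> j then b j else 0)"
      using mono_mat_entry assms j by auto
    then show ?thesis using eq assms(3)[OF j] by (auto split: if_splits)
  qed
  have "\<sigma> j = \<tau> j" for j
    using * assms(1,2) by (cases "j \<in> {1..d}") (auto simp: permutes_not_in)
  then show "\<sigma> = \<tau> \<and> (\<forall>j\<in>{1..d}. a j = b j)" using * by auto
qed (auto intro: mono_mat_cong)

lemma mono_mat_in_S_group:
  assumes \<sigma>: "\<sigma> permutes {1..d}" and "l > 0" and a: "\<And>j. j \<in> {1..d} \<Longrightarrow> a j \<in> roots_of_1 l"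
  shows "mono_mat d \<sigma> a \<in> carrier (S_group l d)"
proof -
  have nz: "a j \<noteq> 0" if "j \<in> {1..d}" for j
    using a[OF that] \<open>l > 0\<close> by (auto simp: roots_of_1_def power_0_left)
  have bnd: "\<sigma> (Suc j) \<in> {1..d}" if "j < d" for j
    using permutes_in_image[OF \<sigma>, of "Suc j"] that by auto
  have inv_bnd: "inv' \<sigma> (Suc j) \<in> {1..d}" if "j < d" for j
    using permutes_in_image[OF permutes_inv[OF \<sigma>], of "Suc j"] that by auto
  have ent: "mono_mat d \<sigma> a $$ (i, j) = (if Suc i = \<sigma> (Suc j) then a (Suc j) else 0)" if "i < d" "j < d" for i j
    using that by (simp add: mono_mat_def)
  have "\<exists>!j. j < d \<and> mono_mat d \<sigma> a $$ (i, j) \<noteq> 0" if i: "i < d" for i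
  proof (rule ex1I[of _ "inv' \<sigma> (Suc i) - 1"])
    have "Suc i = \<sigma> (inv' \<sigma> (Suc i))" using permutes_inverses[OF \<sigma>] by simp
    then show "inv' \<sigma> (Suc i) - 1 < d \<and> mono_mat d \<sigma> a $$ (i, inv' \<sigma> (Suc i) - 1) \<noteq> 0"
      using inv_bnd[OF i] i nz by (auto simp: ent)
  next
    fix j assume "j < d \<and> mono_mat d \<sigma> a $$ (i, j) \<noteq> 0"
    then have "Suc i = \<sigma> (Suc j)" using i by (auto simp: ent split: if_splits)
    then show "j = inv' \<sigma> (Suc i) - 1" using permutes_inverses[OF \<sigma>] by simp
  qed
  moreover have "\<exists>!i. i < d \<and> mono_mat d \<sigma> a $$ (i, j) \<noteq> 0" if j: "j < d" for j
    using bnd[OF j] j nz by (intro ex1I[of _ "\<sigma> (Suc j) - 1"]) (auto simp: ent split: if_splits)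
  ultimately show ?thesis
    using a by (auto simp: S_group_def ent split: if_splits)
qed

text \<open>The column condition picks the row \<open>s j\<close> of the non-zero entry of column
  \<open>j\<close>; the row condition makes \<open>s\<close> injective, hence a permutation by
  finiteness.\<close>

lemma S_group_imp_mono_mat:
  assumes M: "M \<in> carrier (S_group l d)"
  obtains \<sigma> a where "\<sigma> permutes {1..d}" "\<And>j. j \<in> {1..d} \<Longrightarrow> a j \<in> roots_of_1 l" "M = mono_mat d \<sigma> a"
proof -
  have dim: "M \<in> carrier_mat d d"
    and row: "\<And>i. i < d \<Longrightarrow> \<exists>!j. j < d \<and> M $$ (i, j) \<noteq> 0"
    and col: "\<And>j. j < d \<Longrightarrow> \<exists>!i. i < d \<and> M $$ (i, j) \<noteq> 0"
    and rt: "\<And>i j. i < d \<Longrightarrow> j < d \<Longrightarrow> M $$ (i, j) \<noteq> 0 \<Longrightarrow> M $$ (i, j) \<in> roots_of_1 l"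
    using M by (auto simp: S_group_def)
  from col obtain s where s: "\<And>j. j < d \<Longrightarrow> s j < d \<and> M $$ (s j, j) \<noteq> 0" by metis
  have uniq: "i = s j" if "i < d" "j < d" "M $$ (i, j) \<noteq> 0" for i j
    using col[OF that(2)] s[OF that(2)] that by blast
  define \<sigma> where "\<sigma> j = (if j \<in> {1..d} then Suc (s (j - 1)) else j)" for j
  have sinj: "inj_on s {..<d}"
  proof (rule inj_onI)
    fix i j assume ij: "i \<in> {..<d}" "j \<in> {..<d}" "s i = s j"
    then show "i = j" using row[of "s i"] s[of i] s[of j] by auto
  qed
  have "inj_on \<sigma> {1..d}"
  proof (rule inj_onI)
    fix x y assume "x \<in> {1..d}" "y \<in> {1..d}" "\<sigma> x = \<sigma> y"
    then have "x - 1 = y - 1" using sinj by (auto simp: \<sigma>_def intro!: inj_onD[OF sinj])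
    then show "x = y" using \<open>x \<in> {1..d}\<close> \<open>y \<in> {1..d}\<close> by auto
  qed
  moreover have "\<sigma> ` {1..d} \<subseteq> {1..d}"
  proof
    fix y assume "y \<in> \<sigma> ` {1..d}"
    then obtain x where "x \<in> {1..d}" "y = Suc (s (x - 1))" by (auto simp: \<sigma>_def)
    moreover from this have "x - 1 < d" by auto
    ultimately show "y \<in> {1..d}" using s[of "x - 1"] by auto
  qed
  ultimately have "bij_betw \<sigma> {1..d} {1..d}"
    by (simp add: bij_betw_def endo_inj_surj)
  then have perm: "\<sigma> permutes {1..d}"
    by (intro bij_imp_permutes) (auto simp: \<sigma>_def)
  show thesis
  proof
    show "\<sigma> permutes {1..d}" by fact
    show "M $$ (\<sigma> j - 1, j - 1) \<in> roots_of_1 l" if "j \<in> {1..d}" for j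
      using s[of "j - 1"] that rt by (auto simp: \<sigma>_def)
    show "M = mono_mat d \<sigma> (\<lambda>j. M $$ (\<sigma> j - 1, j - 1))"
      using dim by (intro eq_matI) (auto simp: mono_mat_def \<sigma>_def dest: uniq)
  qed
qed

text \<open>Each column holds exactly one non-zero position, so columns index the product. Unlike
  the determinant it carries no sign of \<open>\<sigma>\<close>.\<close>

lemma nonzero_entries_prod_mono_mat:
  assumes \<sigma>: "\<sigma> permutes {1..d}" and nz: "\<And>j. j \<in> {1..d} \<Longrightarrow> a j \<noteq> 0"
  shows "nonzero_entries_prod d (mono_mat d \<sigma> a) = (\<Prod>j\<in>{1..d}. a j)"
  unfolding nonzero_entries_prod_def
proof (rule prod.reindex_bij_witness[of _ "\<lambda>j. (\<sigma> j - 1, j - 1)" "\<lambda>(i, j). Suc j"])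
  fix j assume j: "j \<in> {1..d}"
  then have s: "\<sigma> j \<in> {1..d}" using permutes_in_image[OF \<sigma>] by blast
  have "mono_mat d \<sigma> a $$ (\<sigma> j - 1, j - 1) = a j"
    using mono_mat_entry[OF \<sigma> j s] by simp
  then show "(\<sigma> j - 1, j - 1) \<in> {(i, j). i < d \<and> j < d \<and> mono_mat d \<sigma> a $$ (i, j) \<noteq> 0}"
    using j s nz by auto
qed (auto simp: mono_mat_def split: if_splits)

section \<open>Group algebras and groupoid algebras\<close>

lemma basis_elt_in_carrier: "b \<in> B \<Longrightarrow> basis_elt b \<in> carrier (basis_algebra B P U)"
  by (auto simp: basis_algebra_def basis_elt_def)

text \<open>Induction on the support: additivity and the scalar law peel off one basis element at a
  time from the truncations \<open>r T\<close> of \<open>a\<close>.\<close>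

lemma algebra_hom_eqI:
  assumes "finite B"
    and \<phi>: "\<phi> \<in> algebra_hom (basis_algebra B P U) (basis_algebra B' P' U')"
    and \<psi>: "\<psi> \<in> algebra_hom (basis_algebra B P U) (basis_algebra B' P' U')"
    and eq: "\<And>b. b \<in> B \<Longrightarrow> \<phi> (basis_elt b) = \<psi> (basis_elt b)"
    and a: "a \<in> carrier (basis_algebra B P U)"
  shows "\<phi> a = \<psi> a"
proof -
  let ?A = "basis_algebra B P U" and ?A' = "basis_algebra B' P' U'"
  define r where "r T = (\<lambda>x. if x \<in> T then a x else 0)" for T
  have "T \<subseteq> B \<Longrightarrow> \<phi> (r T) = \<psi> (r T)" if "finite T" for T
    using that
  proof (induction T)
    case empty
    \<comment> \<open>Preservation of zero is drawn from the scalar law, by writing the zero element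
      as \<open>0\<close> times itself.\<close>
    have z: "0 \<odot>\<^bsub>?A\<^esub> r {} = r {}" "r {} \<in> carrier ?A"
      by (auto simp: r_def basis_algebra_def)
    have "\<chi> (r {}) = 0 \<odot>\<^bsub>?A'\<^esub> \<chi> (r {})" if "\<chi> \<in> algebra_hom ?A ?A'" for \<chi>
    proof -
      have "\<chi> (0 \<odot>\<^bsub>?A\<^esub> r {}) = 0 \<odot>\<^bsub>?A'\<^esub> \<chi> (r {})"
        using that z(2) by (simp add: algebra_hom_def)
      then show ?thesis by (simp add: z(1))
    qed
    from this[OF \<phi>] this[OF \<psi>] have "\<phi> (r {}) = 0 \<odot>\<^bsub>?A'\<^esub> \<phi> (r {})" "\<psi> (r {}) = 0 \<odot>\<^bsub>?A'\<^esub> \<psi> (r {})" .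
    then show ?case by (simp add: basis_algebra_def)
  next
    case (insert b T)
    have c: "r T \<in> carrier ?A" "basis_elt b \<in> carrier ?A" "a b \<odot>\<^bsub>?A\<^esub> basis_elt b \<in> carrier ?A"
      using a insert.prems by (auto simp: r_def basis_algebra_def basis_elt_def)
    have split: "r (insert b T) = (a b \<odot>\<^bsub>?A\<^esub> basis_elt b) \<oplus>\<^bsub>?A\<^esub> r T"
      using insert.hyps by (auto simp: r_def basis_algebra_def basis_elt_def fun_eq_iff)
    have "\<chi> (r (insert b T)) = (a b \<odot>\<^bsub>?A'\<^esub> \<chi> (basis_elt b)) \<oplus>\<^bsub>?A'\<^esub> \<chi> (r T)"
      if "\<chi> \<in> algebra_hom ?A ?A'" for \<chi>
      using that c unfolding split algebra_hom_def by (simp add: ring_hom_def)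
    then show ?case using \<phi> \<psi> eq insert by simp
  qed
  from this[OF \<open>finite B\<close>] have "\<phi> (r B) = \<psi> (r B)" by simp
  moreover have "r B = a" using a by (auto simp: r_def basis_algebra_def)
  ultimately show ?thesis by simp
qed

section \<open>Coordinates on the groupoid\<close>

lemma G_groupoid_simps [simp]:
  "Src (G_groupoid l d) (f, \<sigma>, g) = f"
  "Tgt (G_groupoid l d) (f, \<sigma>, g) = g"
  "Cmp (G_groupoid l d) (f', \<tau>, g') (f, \<sigma>, g) = (f, \<tau> \<circ> \<sigma>, g')"
  "Idm (G_groupoid l d) f = (f, id, f)"
  "Obj (G_groupoid l d) = G_objs l d"
  by (simp_all add: G_groupoid_def)

lemma finite_G_objs [simp]: "finite (G_objs l d)"
  by (simp add: G_objs_def finite_PiE)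

lemma G_objs_range:
  assumes "f \<in> G_objs l d" "j \<in> {1..d}"
  shows "f j \<in> {1..l}" "f j > 0"
  using assms by (auto simp: G_objs_def dest!: PiE_mem)

lemma G_objs_comp:
  assumes "f \<in> G_objs l d" "\<sigma> permutes {1..d}"
  shows "f \<circ> \<sigma> \<in> G_objs l d"
  using assms permutes_in_image[OF assms(2)] permutes_not_in[OF assms(2)]
  unfolding G_objs_def by (auto simp: PiE_iff extensional_def)

text \<open>As \<open>\<sigma>\<close> is invertible, the target is forced, so source and bijection
  are coordinates on the morphisms. The transform is computed in these coordinates.\<close>

lemma G_groupoid_Mor_iff:
  "(f, \<sigma>, g) \<in> Mor (G_groupoid l d) \<longleftrightarrow>
    f \<in> G_objs l d \<and> \<sigma> permutes {1..d} \<and> g = f \<circ> inv' \<sigma>"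
proof (cases "\<sigma> permutes {1..d}")
  case True
  then have "g \<circ> \<sigma> = f \<longleftrightarrow> g = f \<circ> inv' \<sigma>"
    using permutes_inv_o[OF True] by (metis comp_assoc comp_id)
  moreover have "f \<circ> inv' \<sigma> \<in> G_objs l d" if "f \<in> G_objs l d"
    using G_objs_comp[OF that permutes_inv[OF True]] .
  ultimately show ?thesis using True by (simp add: G_groupoid_def) blast
qed (auto simp: G_groupoid_def)

lemma G_groupoid_Mor_I:
  "f \<in> G_objs l d \<Longrightarrow> \<sigma> permutes {1..d} \<Longrightarrow> (f, \<sigma>, f \<circ> inv' \<sigma>) \<in> Mor (G_groupoid l d)"
  by (simp add: G_groupoid_Mor_iff)

lemma G_groupoid_Cmp_Mor:
  assumes "P \<in> Mor (G_groupoid l d)" "Q \<in> Mor (G_groupoid l d)"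
    and "Src (G_groupoid l d) P = Tgt (G_groupoid l d) Q"
  shows "Cmp (G_groupoid l d) P Q \<in> Mor (G_groupoid l d)"
  using assms by (cases P; cases Q) (auto simp: G_groupoid_def permutes_compose)

section \<open>Finiteness and closure of S(l,d)\<close>

lemma finite_S_group:
  assumes "l > 0"
  shows "finite (carrier (S_group l d))"
proof -
  have "finite (roots_of_1 l)" using finite_roots_unity[of l] assms by (simp add: roots_of_1_def)
  then have fin: "finite ({\<sigma>. \<sigma> permutes {1..d}} \<times> ({1..d} \<rightarrow>\<^sub>E roots_of_1 l))"
    by (intro finite_cartesian_product finite_permutations finite_PiE) auto
  have "M \<in> (\<lambda>(\<sigma>, a). mono_mat d \<sigma> a) ` ({\<sigma>. \<sigma> permutes {1..d}} \<times> ({1..d} \<rightarrow>\<^sub>E roots_of_1 l))"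
    if M: "M \<in> carrier (S_group l d)" for M
  proof -
    obtain \<sigma> a where *: "\<sigma> permutes {1..d}" "\<And>j. j \<in> {1..d} \<Longrightarrow> a j \<in> roots_of_1 l" "M = mono_mat d \<sigma> a"
      by (rule S_group_imp_mono_mat[OF M]) blast
    \<comment> \<open>Only the values on \<open>{1..d}\<close> enter the matrix; after restriction
      \<open>a\<close> lies in a finite space of extensional functions.\<close>
    then have "M = mono_mat d \<sigma> (restrict a {1..d})" by (auto intro: mono_mat_cong)
    with * show ?thesis by (intro image_eqI[of _ _ "(\<sigma>, restrict a {1..d})"]) auto
  qed
  then show ?thesis by (rule finite_subset[OF subsetI finite_imageI[OF fin]])
qed

lemma roots_of_1_mult: "a \<in> roots_of_1 l \<Longrightarrow> b \<in> roots_of_1 l \<Longrightarrow> a * b \<in> roots_of_1 l"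
  by (simp add: roots_of_1_def power_mult_distrib)

lemma roots_of_1_nonzero: "a \<in> roots_of_1 l \<Longrightarrow> l > 0 \<Longrightarrow> a \<noteq> 0"
  by (auto simp: roots_of_1_def power_0_left)

lemma S_group_mult_closed:
  assumes "l > 0" "M \<in> carrier (S_group l d)" "N \<in> carrier (S_group l d)"
  shows "M * N \<in> carrier (S_group l d)"
proof -
  obtain \<sigma> a where M: "\<sigma> permutes {1..d}" "\<And>j. j \<in> {1..d} \<Longrightarrow> a j \<in> roots_of_1 l" "M = mono_mat d \<sigma> a"
    by (rule S_group_imp_mono_mat[OF assms(2)]) blast
  obtain \<tau> b where N: "\<tau> permutes {1..d}" "\<And>j. j \<in> {1..d} \<Longrightarrow> b j \<in> roots_of_1 l" "N = mono_mat d \<tau> b"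
    by (rule S_group_imp_mono_mat[OF assms(3)]) blast
  have "mono_mat d (\<sigma> \<circ> \<tau>) (\<lambda>j. a (\<tau> j) * b j) \<in> carrier (S_group l d)"
    using M N permutes_in_image[OF N(1)] assms(1)
    by (intro mono_mat_in_S_group permutes_compose roots_of_1_mult) auto
  then show ?thesis using M N by (simp add: mono_mat_mult)
qed

lemma S_group_one: "l > 0 \<Longrightarrow> 1\<^sub>m d \<in> carrier (S_group l d)"
  unfolding one_mat_eq_mono_mat by (intro mono_mat_in_S_group) (auto simp: roots_of_1_def)

lemma S_group_ops [simp]:
  "x \<otimes>\<^bsub>S_group l d\<^esub> y = x * y" "\<one>\<^bsub>S_group l d\<^esub> = 1\<^sub>m d"
  by (simp_all add: S_group_def)

section \<open>The isomorphism as a discrete Fourier transform\<close>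

text \<open>The coefficient of a morphism in the image of \<open>M\<close>, read off the entries of
  \<open>M\<close> at the positions prescribed by the bijection, so that no decomposition of
  \<open>M\<close> has to be chosen.\<close>

definition mat_char :: "nat \<Rightarrow> complex mat \<Rightarrow> mor \<Rightarrow> complex" where
  "mat_char d M = (\<lambda>(f, \<sigma>, g). \<Prod>j\<in>{1..d}. (M $$ (\<sigma> j - 1, j - 1)) ^ f j)"

text \<open>Objects take positive values, so a vanishing entry kills the product: only morphisms with the
  same underlying permutation as the matrix contribute.\<close>

lemma mat_char_mono_mat:
  assumes "\<sigma> permutes {1..d}" "\<tau> permutes {1..d}" "f \<in> G_objs l d"
  shows "mat_char d (mono_mat d \<sigma> a) (f, \<tau>, g) = (if \<sigma> = \<tau> then \<Prod>j\<in>{1..d}. a j ^ f j else 0)"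
proof -
  have ent: "mono_mat d \<sigma> a $$ (\<tau> j - 1, j - 1) = (if \<sigma> j = \<tau> j then a j else 0)" if "j \<in> {1..d}" for j
    using mono_mat_entry[OF assms(1) that, of "\<tau> j"] permutes_in_image[OF assms(2)] that by auto
  show ?thesis
  proof (cases "\<sigma> = \<tau>")
    case True
    then show ?thesis using ent by (auto simp: mat_char_def intro!: prod.cong)
  next
    case False
    then obtain j where j: "\<sigma> j \<noteq> \<tau> j" by auto
    then have "j \<in> {1..d}" using assms permutes_not_in by metis
    moreover have "(mono_mat d \<sigma> a $$ (\<tau> j - 1, j - 1)) ^ f j = 0"
      using ent[OF \<open>j \<in> {1..d}\<close>] j G_objs_range(2)[OF assms(3) \<open>j \<in> {1..d}\<close>] by simp
    ultimately have "\<exists>j\<in>{1..d}. (mono_mat d \<sigma> a $$ (\<tau> j - 1, j - 1)) ^ f j = 0" by blast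
    then show ?thesis using False by (simp add: mat_char_def)
  qed
qed

text \<open>The value 0 off the morphisms puts the result into the carrier of \<open>A_alg\<close>;
  the restriction supplies the extensionality demanded by \<open>is_Phi\<close>.\<close>

definition fourier :: "nat \<Rightarrow> nat \<Rightarrow> (complex mat \<Rightarrow> complex) \<Rightarrow> mor \<Rightarrow> complex" where
  "fourier l d = restrict
    (\<lambda>a m. if m \<in> Mor (G_groupoid l d)
      then \<Sum>M\<in>carrier (S_group l d). a M * mat_char d M m else 0)
    (carrier (group_algebra (S_group l d)))"

lemma group_algebra_S_carrier:
  "carrier (group_algebra (S_group l d)) = {a. \<forall>x. x \<notin> carrier (S_group l d) \<longrightarrow> a x = 0}"
  by (simp add: group_algebra_def basis_algebra_def)

lemma A_alg_carrier:
  "carrier (A_alg l d) = {a. \<forall>m. m \<notin> Mor (G_groupoid l d) \<longrightarrow> a m = 0}"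
  by (simp add: A_alg_def groupoid_algebra_def basis_algebra_def)

lemma group_algebra_S_mult:
  "(a \<otimes>\<^bsub>group_algebra (S_group l d)\<^esub> b) x =
    (\<Sum>(p, q) \<in> {(p, q). p \<in> carrier (S_group l d) \<and> q \<in> carrier (S_group l d) \<and> p * q = x}. a p * b q)"
  by (simp add: group_algebra_def basis_algebra_def)

section \<open>Multiplicativity of the transform\<close>

lemma inv_comp_quotient:
  assumes "\<sigma> permutes A" "\<rho> permutes A"
  shows "inv' \<sigma> \<circ> inv' (\<rho> \<circ> inv' \<sigma>) = inv' \<rho>"
proof -
  have "inv' (\<rho> \<circ> inv' \<sigma>) = \<sigma> \<circ> inv' \<rho>"
    using o_inv_distrib[OF permutes_bij[OF assms(2)] permutes_bij[OF permutes_inv[OF assms(1)]]]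
    by (simp add: permutes_inv_inv[OF assms(1)])
  then show ?thesis
    using permutes_inv_o(2)[OF assms(1)] by (simp flip: comp_assoc)
qed

text \<open>In a groupoid a factorization of an arrow is determined by the factor applied first, and
  an arrow leaving \<open>f\<close> is determined by its bijection. The convolution therefore
  becomes a sum over the symmetric group.\<close>

lemma A_alg_mult:
  assumes "f \<in> G_objs l d" "\<rho> permutes {1..d}"
  shows "(a \<otimes>\<^bsub>A_alg l d\<^esub> b) (f, \<rho>, f \<circ> inv' \<rho>) =
    (\<Sum>\<sigma> | \<sigma> permutes {1..d}. a (f \<circ> inv' \<sigma>, \<rho> \<circ> inv' \<sigma>, f \<circ> inv' \<rho>) * b (f, \<sigma>, f \<circ> inv' \<sigma>))"
proof -
  let ?C = "G_groupoid l d"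
  let ?m = "(f, \<rho>, f \<circ> inv' \<rho>)"
  have "(a \<otimes>\<^bsub>A_alg l d\<^esub> b) ?m =
      (\<Sum>(p, q) \<in> {(p, q). p \<in> Mor ?C \<and> q \<in> Mor ?C \<and> Src ?C p = Tgt ?C q \<and> Cmp ?C p q = ?m}. a p * b q)"
    by (auto simp: A_alg_def groupoid_algebra_def basis_algebra_def intro!: sum.cong split: if_splits)
  also have "\<dots> = (\<Sum>\<sigma> | \<sigma> permutes {1..d}. a (f \<circ> inv' \<sigma>, \<rho> \<circ> inv' \<sigma>, f \<circ> inv' \<rho>) * b (f, \<sigma>, f \<circ> inv' \<sigma>))"
  proof (rule sum.reindex_bij_witness[of _
        "\<lambda>\<sigma>. ((f \<circ> inv' \<sigma>, \<rho> \<circ> inv' \<sigma>, f \<circ> inv' \<rho>), (f, \<sigma>, f \<circ> inv' \<sigma>))" "\<lambda>(p, q). fst (snd q)"], goal_cases)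
    case (1 x)
    obtain f1 \<tau> g1 f2 \<sigma> g2 where x: "x = ((f1, \<tau>, g1), (f2, \<sigma>, g2))" by (metis prod.exhaust)
    with 1 have *: "f2 = f" "\<tau> \<circ> \<sigma> = \<rho>" "g1 = f \<circ> inv' \<rho>" "f1 = f \<circ> inv' \<sigma>" "g2 = f \<circ> inv' \<sigma>" "\<sigma> permutes {1..d}"
      by (auto simp: G_groupoid_Mor_iff)
    have "\<tau> = \<rho> \<circ> inv' \<sigma>"
      using *(2) permutes_inv_o[OF *(6)] by (metis comp_assoc comp_id)
    with * x show ?case by simp
  next
    case (2 x)
    then show ?case by (auto simp: G_groupoid_Mor_iff)
  next
    case (3 \<sigma>)
    then show ?case by simp
  next
    case (4 \<sigma>)
    then have s: "\<sigma> permutes {1..d}" by simp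
    have t: "\<rho> \<circ> inv' \<sigma> permutes {1..d}" using s assms by (simp add: permutes_compose permutes_inv)
    have "f \<circ> inv' \<rho> = f \<circ> inv' \<sigma> \<circ> inv' (\<rho> \<circ> inv' \<sigma>)"
      using inv_comp_quotient[OF s assms(2)] by (simp add: comp_assoc)
    moreover have "\<rho> \<circ> inv' \<sigma> \<circ> \<sigma> = \<rho>" using permutes_inv_o[OF s] by (simp add: comp_assoc)
    ultimately show ?case
      using s t assms G_objs_comp[OF assms(1) permutes_inv[OF s]] by (simp add: G_groupoid_Mor_iff)
  next
    case (5 x)
    obtain f1 \<tau> g1 f2 \<sigma> g2 where x: "x = ((f1, \<tau>, g1), (f2, \<sigma>, g2))" by (metis prod.exhaust)
    with 5 have *: "f2 = f" "\<tau> \<circ> \<sigma> = \<rho>" "g1 = f \<circ> inv' \<rho>" "f1 = f \<circ> inv' \<sigma>" "g2 = f \<circ> inv' \<sigma>" "\<sigma> permutes {1..d}"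
      by (auto simp: G_groupoid_Mor_iff)
    have "\<tau> = \<rho> \<circ> inv' \<sigma>"
      using *(2) permutes_inv_o[OF *(6)] by (metis comp_assoc comp_id)
    with * x show ?case by simp
  qed
  finally show ?thesis .
qed

lemma A_alg_mult_closed: "a \<otimes>\<^bsub>A_alg l d\<^esub> b \<in> carrier (A_alg l d)"
proof -
  let ?C = "G_groupoid l d"
  have "(a \<otimes>\<^bsub>A_alg l d\<^esub> b) m = 0" if "m \<notin> Mor ?C" for m
  proof -
    have *: "{(p, q). p \<in> Mor ?C \<and> q \<in> Mor ?C \<and>
        (if Src ?C p = Tgt ?C q then Some (Cmp ?C p q) else None) = Some m} = {}"
      using that G_groupoid_Cmp_Mor[of _ l d] by (auto split: if_splits)
    show ?thesis
      unfolding A_alg_def groupoid_algebra_def basis_algebra_def monoid.simps * by simp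
  qed
  then show ?thesis by (simp add: A_alg_carrier)
qed

text \<open>The factor at \<open>q\<close> vanishes unless \<open>\<sigma>\<close> is the
  permutation \<open>\<tau>\<close> of \<open>q\<close>, so one summand remains. In it, reindexing
  by \<open>\<tau>\<close> produces the powers of \<open>a (\<tau> j)\<close>, which are the entries
  that the product matrix takes from \<open>p\<close>.\<close>

lemma mat_char_mult:
  assumes "p \<in> carrier (S_group l d)" "q \<in> carrier (S_group l d)"
    and f: "f \<in> G_objs l d" and \<rho>: "\<rho> permutes {1..d}"
  shows "(\<Sum>\<sigma> | \<sigma> permutes {1..d}.
      mat_char d p (f \<circ> inv' \<sigma>, \<rho> \<circ> inv' \<sigma>, g) * mat_char d q (f, \<sigma>, g' \<sigma>)) = mat_char d (p * q) (f, \<rho>, g)"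
proof -
  obtain \<pi> a where p: "\<pi> permutes {1..d}" "p = mono_mat d \<pi> a"
    using S_group_imp_mono_mat[OF assms(1)] by metis
  obtain \<tau> b where q: "\<tau> permutes {1..d}" "q = mono_mat d \<tau> b"
    using S_group_imp_mono_mat[OF assms(2)] by metis
  have perm: "\<rho> \<circ> inv' \<sigma> permutes {1..d}" if "\<sigma> permutes {1..d}" for \<sigma>
    using that \<rho> by (simp add: permutes_compose permutes_inv)
  have "(\<Sum>\<sigma> | \<sigma> permutes {1..d}. mat_char d p (f \<circ> inv' \<sigma>, \<rho> \<circ> inv' \<sigma>, g) * mat_char d q (f, \<sigma>, g' \<sigma>)) =
      (\<Sum>\<sigma> | \<sigma> permutes {1..d}. if \<sigma> = \<tau> then
        mat_char d p (f \<circ> inv' \<tau>, \<rho> \<circ> inv' \<tau>, g) * (\<Prod>j\<in>{1..d}. b j ^ f j) else 0)"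
    using q f by (intro sum.cong) (auto simp: mat_char_mono_mat)
  also have "\<dots> = mat_char d p (f \<circ> inv' \<tau>, \<rho> \<circ> inv' \<tau>, g) * (\<Prod>j\<in>{1..d}. b j ^ f j)"
    using q(1) by (simp add: finite_permutations)
  also have "mat_char d p (f \<circ> inv' \<tau>, \<rho> \<circ> inv' \<tau>, g) =
      (if \<pi> = \<rho> \<circ> inv' \<tau> then \<Prod>i\<in>{1..d}. a i ^ (f (inv' \<tau> i)) else 0)"
    unfolding p(2) using mat_char_mono_mat[OF p(1) perm[OF q(1)] G_objs_comp[OF f permutes_inv[OF q(1)]]] by simp
  also have "(\<Prod>i\<in>{1..d}. a i ^ (f (inv' \<tau> i))) = (\<Prod>j\<in>{1..d}. a (\<tau> j) ^ f j)"
    using prod.permute[OF q(1), of "\<lambda>i. a i ^ (f (inv' \<tau> i))"] permutes_inverses[OF q(1)] by (simp add: o_def)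
  also have "\<pi> = \<rho> \<circ> inv' \<tau> \<longleftrightarrow> \<pi> \<circ> \<tau> = \<rho>"
    using permutes_inv_o[OF q(1)] by (metis comp_assoc comp_id)
  also have "(if \<pi> \<circ> \<tau> = \<rho> then \<Prod>j\<in>{1..d}. a (\<tau> j) ^ f j else 0) * (\<Prod>j\<in>{1..d}. b j ^ f j) =
      mat_char d (p * q) (f, \<rho>, g)"
    unfolding p(2) q(2) mono_mat_mult[OF q(1)]
      mat_char_mono_mat[OF permutes_compose[OF q(1) p(1)] \<rho> f]
    by (auto simp: power_mult_distrib prod.distrib)
  finally show ?thesis .
qed

lemma fourier_apply:
  assumes "a \<in> carrier (group_algebra (S_group l d))"
  shows "fourier l d a m = (if m \<in> Mor (G_groupoid l d)
      then \<Sum>M\<in>carrier (S_group l d). a M * mat_char d M m else 0)"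
  using assms by (simp add: fourier_def)

lemma fourier_basis_elt:
  assumes "l > 0" "M \<in> carrier (S_group l d)"
  shows "fourier l d (basis_elt M) m = (if m \<in> Mor (G_groupoid l d) then mat_char d M m else 0)"
proof -
  have "(\<Sum>N\<in>carrier (S_group l d). basis_elt M N * mat_char d N m) =
      (\<Sum>N\<in>carrier (S_group l d). if N = M then mat_char d M m else 0)"
    by (rule sum.cong) (auto simp: basis_elt_def)
  moreover have "basis_elt M \<in> carrier (group_algebra (S_group l d))"
    using assms by (simp add: group_algebra_def basis_elt_in_carrier)
  ultimately show ?thesis using assms finite_S_group[OF assms(1)] by (simp add: fourier_apply)
qed

lemma group_algebra_S_mult_closed:
  assumes "l > 0"
  shows "a \<otimes>\<^bsub>group_algebra (S_group l d)\<^esub> b \<in> carrier (group_algebra (S_group l d))"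
proof -
  have "(a \<otimes>\<^bsub>group_algebra (S_group l d)\<^esub> b) x = 0" if "x \<notin> carrier (S_group l d)" for x
    unfolding group_algebra_S_mult
    using S_group_mult_closed[OF assms] that by (intro sum.neutral) auto
  then show ?thesis by (simp add: group_algebra_S_carrier)
qed

text \<open>The bilinear extension of \<open>mat_char_mult\<close>: pairs are grouped by their
  product, and after exchanging sums the formula of \<open>A_alg_mult\<close> appears.\<close>

lemma fourier_mult:
  assumes l: "l > 0"
    and a: "a \<in> carrier (group_algebra (S_group l d))" and b: "b \<in> carrier (group_algebra (S_group l d))"
  shows "fourier l d (a \<otimes>\<^bsub>group_algebra (S_group l d)\<^esub> b) = fourier l d a \<otimes>\<^bsub>A_alg l d\<^esub> fourier l d b"
proof
  fix m
  let ?S = "carrier (S_group l d)"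
  let ?ab = "a \<otimes>\<^bsub>group_algebra (S_group l d)\<^esub> b"
  have ab: "?ab \<in> carrier (group_algebra (S_group l d))"
    by (rule group_algebra_S_mult_closed[OF l])
  show "fourier l d ?ab m = (fourier l d a \<otimes>\<^bsub>A_alg l d\<^esub> fourier l d b) m"
  proof (cases "m \<in> Mor (G_groupoid l d)")
    case False
    then have "(fourier l d a \<otimes>\<^bsub>A_alg l d\<^esub> fourier l d b) m = 0"
      using A_alg_mult_closed[of l d "fourier l d a" "fourier l d b"] unfolding A_alg_carrier by blast
    then show ?thesis using False ab by (simp add: fourier_apply)
  next
    case True
    then obtain f \<rho> where m: "m = (f, \<rho>, f \<circ> inv' \<rho>)" and f: "f \<in> G_objs l d" and \<rho>: "\<rho> permutes {1..d}"
      by (metis G_groupoid_Mor_iff prod.exhaust)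
    have fin: "finite ?S" by (rule finite_S_group[OF l])
    have eq: "?ab x * mat_char d x m = (\<Sum>r\<in>{r \<in> ?S \<times> ?S. fst r * snd r = x}.
        a (fst r) * b (snd r) * mat_char d (fst r * snd r) m)" for x
      unfolding group_algebra_S_mult sum_distrib_right by (rule sum.cong) auto
    have "fourier l d ?ab m = (\<Sum>x\<in>?S. \<Sum>r\<in>{r \<in> ?S \<times> ?S. fst r * snd r = x}.
        a (fst r) * b (snd r) * mat_char d (fst r * snd r) m)"
      using True ab by (simp add: fourier_apply eq)
    \<comment> \<open>The fibres of the multiplication partition all pairs, because products stay in
      the group.\<close>
    also have "\<dots> = (\<Sum>r\<in>?S \<times> ?S. a (fst r) * b (snd r) * mat_char d (fst r * snd r) m)"
      using S_group_mult_closed[OF l] fin by (intro sum.group) auto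
    also have "\<dots> = (\<Sum>p\<in>?S. \<Sum>q\<in>?S. a p * b q * mat_char d (p * q) m)"
      by (simp add: sum.cartesian_product split_def)
    also have "\<dots> = (\<Sum>p\<in>?S. \<Sum>q\<in>?S. a p * b q * (\<Sum>\<sigma> | \<sigma> permutes {1..d}.
        mat_char d p (f \<circ> inv' \<sigma>, \<rho> \<circ> inv' \<sigma>, f \<circ> inv' \<rho>) * mat_char d q (f, \<sigma>, f \<circ> inv' \<sigma>)))"
      unfolding m by (intro sum.cong refl) (subst mat_char_mult[OF _ _ f \<rho>], auto)
    also have "\<dots> = (\<Sum>p\<in>?S. \<Sum>q\<in>?S. \<Sum>\<sigma> | \<sigma> permutes {1..d}.
        (a p * mat_char d p (f \<circ> inv' \<sigma>, \<rho> \<circ> inv' \<sigma>, f \<circ> inv' \<rho>)) * (b q * mat_char d q (f, \<sigma>, f \<circ> inv' \<sigma>)))"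
      by (simp add: sum_distrib_left mult_ac)
    also have "\<dots> = (\<Sum>p\<in>?S. \<Sum>\<sigma> | \<sigma> permutes {1..d}. \<Sum>q\<in>?S.
        (a p * mat_char d p (f \<circ> inv' \<sigma>, \<rho> \<circ> inv' \<sigma>, f \<circ> inv' \<rho>)) * (b q * mat_char d q (f, \<sigma>, f \<circ> inv' \<sigma>)))"
      by (intro sum.cong refl sum.swap)
    also have "\<dots> = (\<Sum>\<sigma> | \<sigma> permutes {1..d}. \<Sum>p\<in>?S. \<Sum>q\<in>?S.
        (a p * mat_char d p (f \<circ> inv' \<sigma>, \<rho> \<circ> inv' \<sigma>, f \<circ> inv' \<rho>)) * (b q * mat_char d q (f, \<sigma>, f \<circ> inv' \<sigma>)))"
      by (rule sum.swap)
    also have "\<dots> = (\<Sum>\<sigma> | \<sigma> permutes {1..d}.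
        fourier l d a (f \<circ> inv' \<sigma>, \<rho> \<circ> inv' \<sigma>, f \<circ> inv' \<rho>) * fourier l d b (f, \<sigma>, f \<circ> inv' \<sigma>))"
    proof (rule sum.cong[OF refl])
      fix \<sigma> assume "\<sigma> \<in> {\<sigma>. \<sigma> permutes {1..d}}"
      then have s: "\<sigma> permutes {1..d}" by simp
      have t: "\<rho> \<circ> inv' \<sigma> permutes {1..d}" using s \<rho> by (simp add: permutes_compose permutes_inv)
      \<comment> \<open>Both arrows are shown to lie in the groupoid, so that neither transform
        takes its default value 0.\<close>
      have "f \<circ> inv' \<rho> = f \<circ> inv' \<sigma> \<circ> inv' (\<rho> \<circ> inv' \<sigma>)"
        using inv_comp_quotient[OF s \<rho>] by (simp add: comp_assoc)
      then have "(f \<circ> inv' \<sigma>, \<rho> \<circ> inv' \<sigma>, f \<circ> inv' \<rho>) \<in> Mor (G_groupoid l d)"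
        using t G_objs_comp[OF f permutes_inv[OF s]] by (simp add: G_groupoid_Mor_iff)
      moreover have "(f, \<sigma>, f \<circ> inv' \<sigma>) \<in> Mor (G_groupoid l d)"
        using f s by (rule G_groupoid_Mor_I)
      ultimately show "(\<Sum>p\<in>?S. \<Sum>q\<in>?S.
        (a p * mat_char d p (f \<circ> inv' \<sigma>, \<rho> \<circ> inv' \<sigma>, f \<circ> inv' \<rho>)) * (b q * mat_char d q (f, \<sigma>, f \<circ> inv' \<sigma>))) =
        fourier l d a (f \<circ> inv' \<sigma>, \<rho> \<circ> inv' \<sigma>, f \<circ> inv' \<rho>) * fourier l d b (f, \<sigma>, f \<circ> inv' \<sigma>)"
        using a b by (simp add: fourier_apply sum_product)
    qed
    also have "\<dots> = (fourier l d a \<otimes>\<^bsub>A_alg l d\<^esub> fourier l d b) m"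
      unfolding m by (rule A_alg_mult[OF f \<rho>, symmetric])
    finally show ?thesis .
  qed
qed

lemma fourier_one:
  assumes "l > 0"
  shows "fourier l d \<one>\<^bsub>group_algebra (S_group l d)\<^esub> = \<one>\<^bsub>A_alg l d\<^esub>"
proof
  fix m
  have "\<one>\<^bsub>group_algebra (S_group l d)\<^esub> = basis_elt (1\<^sub>m d)"
    by (auto simp: group_algebra_def basis_algebra_def basis_elt_def fun_eq_iff)
  then have "fourier l d \<one>\<^bsub>group_algebra (S_group l d)\<^esub> m =
      (if m \<in> Mor (G_groupoid l d) then mat_char d (mono_mat d id (\<lambda>_. 1)) m else 0)"
    using fourier_basis_elt[OF assms S_group_one[OF assms]] one_mat_eq_mono_mat by simp
  also have "\<dots> = (if m \<in> (\<lambda>f. (f, id, f)) ` G_objs l d then 1 else 0)"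
  proof (cases m)
    case (fields f \<sigma> g)
    then show ?thesis
      using mat_char_mono_mat[OF permutes_id, where a = "\<lambda>_. 1" and d = d and l = l and f = f and \<tau> = \<sigma> and g = g]
      by (auto simp: G_groupoid_Mor_iff)
  qed
  also have "\<dots> = \<one>\<^bsub>A_alg l d\<^esub> m"
    by (auto simp: A_alg_def groupoid_algebra_def basis_algebra_def image_def)
  finally show "fourier l d \<one>\<^bsub>group_algebra (S_group l d)\<^esub> m = \<one>\<^bsub>A_alg l d\<^esub> m" .
qed

lemma fourier_algebra_hom:
  assumes "l > 0"
  shows "fourier l d \<in> algebra_hom (group_algebra (S_group l d)) (A_alg l d)"
proof -
  let ?R = "group_algebra (S_group l d)"
  have "fourier l d a \<in> carrier (A_alg l d)" if "a \<in> carrier ?R" for a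
    using that by (simp add: fourier_apply A_alg_carrier)
  moreover have "fourier l d (a \<oplus>\<^bsub>?R\<^esub> b) = fourier l d a \<oplus>\<^bsub>A_alg l d\<^esub> fourier l d b"
    if "a \<in> carrier ?R" "b \<in> carrier ?R" for a b
  proof -
    have "a \<oplus>\<^bsub>?R\<^esub> b \<in> carrier ?R" using that by (simp add: group_algebra_def basis_algebra_def)
    then show ?thesis using that
      by (auto simp: fun_eq_iff fourier_apply) (auto simp: A_alg_def groupoid_algebra_def group_algebra_def basis_algebra_def distrib_right sum.distrib fourier_apply)
  qed
  moreover have "fourier l d (c \<odot>\<^bsub>?R\<^esub> a) = c \<odot>\<^bsub>A_alg l d\<^esub> fourier l d a" if "a \<in> carrier ?R" for a c
  proof -
    have "c \<odot>\<^bsub>?R\<^esub> a \<in> carrier ?R" using that by (simp add: group_algebra_def basis_algebra_def)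
    then show ?thesis using that
      by (auto simp: fun_eq_iff fourier_apply) (auto simp: A_alg_def groupoid_algebra_def group_algebra_def basis_algebra_def sum_distrib_left mult_ac fourier_apply)
  qed
  ultimately show ?thesis
    using fourier_mult[OF assms] fourier_one[OF assms] by (simp add: algebra_hom_def ring_hom_def)
qed

section \<open>Orthogonality of characters and Fourier inversion\<close>

locale root_generator =
  fixes l :: nat and xi :: complex
  assumes l_pos: "l > 0" and generator: "is_generator_of_roots l xi"
begin

lemma generator_power_in_roots: "xi ^ n \<in> roots_of_1 l"
  using generator unfolding is_generator_of_roots_def by blast

lemma generator_power_nonzero [simp]: "xi ^ n \<noteq> 0"
  using roots_of_1_nonzero[OF generator_power_in_roots l_pos] .

lemma generator_nonzero [simp]: "xi \<noteq> 0"
  using generator_power_nonzero[of 1] by simp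

lemma generator_power_order: "xi ^ l = 1"
  using generator_power_in_roots[of 1] by (simp add: roots_of_1_def)

lemma generator_power_mod: "n mod l = m mod l \<Longrightarrow> xi ^ n = xi ^ m"
proof -
  have "xi ^ n = xi ^ (n mod l)" for n
    using power_add[of xi "l * (n div l)" "n mod l"] by (simp add: power_mult generator_power_order)
  then show "n mod l = m mod l \<Longrightarrow> xi ^ n = xi ^ m" by metis
qed

text \<open>Surjectivity is the generator property with exponents reduced modulo \<open>l\<close>;
  injectivity follows because there are exactly \<open>l\<close> roots.\<close>

lemma bij_betw_generator_power: "bij_betw (\<lambda>n. xi ^ n) {1..l} (roots_of_1 l)"
proof -
  have "z \<in> (\<lambda>n. xi ^ n) ` {1..l}" if z: "z \<in> roots_of_1 l" for z
  proof -
    obtain n where n: "z = xi ^ n"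
      using z generator unfolding is_generator_of_roots_def by blast
    \<comment> \<open>The residue 0 is represented by \<open>l\<close>, in accordance with the
      values of objects.\<close>
    define n' where "n' = (if n mod l = 0 then l else n mod l)"
    have "n' \<in> {1..l}" "n mod l = n' mod l" using l_pos by (auto simp: n'_def mod_le_divisor)
    then show ?thesis using n generator_power_mod by blast
  qed
  then have img: "(\<lambda>n. xi ^ n) ` {1..l} = roots_of_1 l"
    using generator_power_in_roots by blast
  moreover have "card (roots_of_1 l) = card {1..l}"
    using card_roots_unity_eq[OF l_pos] by (simp add: roots_of_1_def)
  ultimately show ?thesis by (simp add: bij_betw_def eq_card_imp_inj_on)
qed

text \<open>Orthogonality of the characters of the cyclic group of order \<open>l\<close>: for
  distinct exponents the sum is a geometric series whose ratio \<open>w\<close> is an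
  \<open>l\<close>-th root of unity other than 1.\<close>

lemma generator_sum:
  assumes c: "c \<in> {1..l}" and c': "c' \<in> {1..l}"
  shows "(\<Sum>f\<in>{1..l}. xi ^ (c * f) * inverse (xi ^ (c' * f))) = (if c = c' then of_nat l else 0)"
proof (cases "c = c'")
  case True
  then show ?thesis by simp
next
  case False
  define w where "w = xi ^ c / xi ^ c'"
  have "w \<noteq> 1"
    using False inj_onD[OF bij_betw_imp_inj_on[OF bij_betw_generator_power], of c c'] c c'
    by (auto simp: w_def)
  have "(xi ^ n) ^ l = 1" for n
    using generator_power_in_roots[of n] by (simp add: roots_of_1_def)
  then have "w ^ l = 1" by (simp add: w_def power_divide)
  have "(\<Sum>f\<in>{1..l}. xi ^ (c * f) * inverse (xi ^ (c' * f))) = (\<Sum>f\<in>{Suc 0..l}. w ^ f)"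
    by (simp add: w_def power_divide power_mult divide_inverse power_mult_distrib power_inverse)
  also have "\<dots> = w * (\<Sum>f<l. w ^ f)"
    by (simp add: sum.atLeast1_atMost_eq sum_distrib_left)
  also have "\<dots> = 0"
    using geometric_sum[OF \<open>w \<noteq> 1\<close>, of l] \<open>w ^ l = 1\<close> by simp
  finally show ?thesis using False by simp
qed

text \<open>The character of the d-th power of the cyclic group with frequency \<open>c\<close>,
  evaluated at \<open>f\<close>. Frequencies have the type of objects, which makes the pairing
  symmetric.\<close>

definition kern :: "nat \<Rightarrow> obj \<Rightarrow> obj \<Rightarrow> complex" where
  "kern d c f = (\<Prod>j\<in>{1..d}. xi ^ (c j * f j))"

lemma kern_commute: "kern d c f = kern d f c"
  by (simp add: kern_def mult.commute)

text \<open>The sum over all objects factors into \<open>d\<close> one-dimensional sums, one of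
  which vanishes as soon as \<open>c\<close> and \<open>c'\<close> differ somewhere.\<close>

lemma kern_orthogonal:
  assumes c: "c \<in> G_objs l d" and c': "c' \<in> G_objs l d"
  shows "(\<Sum>f\<in>G_objs l d. kern d c f * inverse (kern d c' f)) = (if c = c' then of_nat l ^ d else 0)"
proof -
  have "(\<Sum>f\<in>G_objs l d. kern d c f * inverse (kern d c' f)) =
      (\<Sum>f\<in>{1..d} \<rightarrow>\<^sub>E {1..l}. \<Prod>j\<in>{1..d}. xi ^ (c j * f j) * inverse (xi ^ (c' j * f j)))"
    unfolding G_objs_def kern_def prod.distrib prod_inversef[symmetric] comp_def by (rule refl)
  also have "\<dots> = (\<Prod>j\<in>{1..d}. \<Sum>y\<in>{1..l}. xi ^ (c j * y) * inverse (xi ^ (c' j * y)))"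
    by (rule prod_sum_PiE[symmetric]) auto
  also have "\<dots> = (\<Prod>j\<in>{1..d}. if c j = c' j then of_nat l else 0)"
    using G_objs_range(1)[OF c] G_objs_range(1)[OF c'] by (intro prod.cong refl generator_sum)
  also have "\<dots> = (if c = c' then of_nat l ^ d else 0)"
  proof (cases "c = c'")
    case True
    then show ?thesis by simp
  next
    case False
    then obtain j where "j \<in> {1..d}" "c j \<noteq> c' j"
      using c c' unfolding G_objs_def by (metis PiE_ext)
    then have "\<exists>j\<in>{1..d}. (if c j = c' j then of_nat l else 0) = (0 :: complex)" by auto
    then show ?thesis using False by (simp add: prod_zero)
  qed
  finally show ?thesis .
qed

abbreviation powers_mat :: "nat \<Rightarrow> (nat \<Rightarrow> nat) \<Rightarrow> obj \<Rightarrow> complex mat" where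
  "powers_mat d \<sigma> c \<equiv> mono_mat d \<sigma> (\<lambda>j. xi ^ c j)"

lemma powers_mat_in_S_group: "\<sigma> permutes {1..d} \<Longrightarrow> powers_mat d \<sigma> c \<in> carrier (S_group l d)"
  using l_pos by (intro mono_mat_in_S_group generator_power_in_roots)

text \<open>Exponents in \<open>{1..l}\<close> are unique, so for each permutation the matrices are
  indexed by the very set that indexes the sources of the morphisms with that permutation.\<close>

lemma bij_betw_powers_mat:
  "bij_betw (\<lambda>(\<sigma>, c). powers_mat d \<sigma> c) ({\<sigma>. \<sigma> permutes {1..d}} \<times> G_objs l d) (carrier (S_group l d))"
proof (rule bij_betw_imageI)
  show "inj_on (\<lambda>(\<sigma>, c). powers_mat d \<sigma> c) ({\<sigma>. \<sigma> permutes {1..d}} \<times> G_objs l d)"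
  proof (rule inj_onI, clarify)
    fix \<sigma> \<tau> c e
    assume perm: "\<sigma> permutes {1..d}" "\<tau> permutes {1..d}" and obj: "c \<in> G_objs l d" "e \<in> G_objs l d"
      and eq: "powers_mat d \<sigma> c = powers_mat d \<tau> e"
    have *: "\<sigma> = \<tau>" "\<And>j. j \<in> {1..d} \<Longrightarrow> xi ^ c j = xi ^ e j"
      using eq mono_mat_eq_iff[OF perm, of "\<lambda>j. xi ^ c j" "\<lambda>j. xi ^ e j"] by auto
    have "c j = e j" if "j \<in> {1..d}" for j
      using inj_onD[OF bij_betw_imp_inj_on[OF bij_betw_generator_power] *(2)[OF that]]
        G_objs_range(1)[OF obj(1) that] G_objs_range(1)[OF obj(2) that] by blast
    then have "c = e" using obj unfolding G_objs_def by (metis PiE_ext)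
    with * show "\<sigma> = \<tau> \<and> c = e" by simp
  qed
  show "(\<lambda>(\<sigma>, c). powers_mat d \<sigma> c) ` ({\<sigma>. \<sigma> permutes {1..d}} \<times> G_objs l d) = carrier (S_group l d)"
  proof (intro equalityI subsetI)
    fix M assume "M \<in> carrier (S_group l d)"
    then obtain \<sigma> a where M: "\<sigma> permutes {1..d}" "\<And>j. j \<in> {1..d} \<Longrightarrow> a j \<in> roots_of_1 l" "M = mono_mat d \<sigma> a"
      by (rule S_group_imp_mono_mat) blast
    have "\<forall>j\<in>{1..d}. \<exists>n\<in>{1..l}. a j = xi ^ n"
      using M(2) bij_betw_imp_surj_on[OF bij_betw_generator_power] by blast
    then obtain c where c: "\<And>j. j \<in> {1..d} \<Longrightarrow> c j \<in> {1..l} \<and> a j = xi ^ c j" by metis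
    have "restrict c {1..d} \<in> G_objs l d" using c by (auto simp: G_objs_def)
    moreover have "M = powers_mat d \<sigma> (restrict c {1..d})"
      using M(3) c by (auto intro: mono_mat_cong)
    ultimately show "M \<in> (\<lambda>(\<sigma>, c). powers_mat d \<sigma> c) ` ({\<sigma>. \<sigma> permutes {1..d}} \<times> G_objs l d)"
      using M(1) by (intro image_eqI[of _ _ "(\<sigma>, restrict c {1..d})"]) auto
  qed (auto intro: powers_mat_in_S_group)
qed

lemma S_group_imp_powers_mat:
  assumes "M \<in> carrier (S_group l d)"
  obtains \<sigma> c where "\<sigma> permutes {1..d}" "c \<in> G_objs l d" "M = powers_mat d \<sigma> c"
  using assms unfolding bij_betw_imp_surj_on[OF bij_betw_powers_mat[of d], symmetric] by auto

lemma mat_char_powers_mat: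
  assumes "\<sigma> permutes {1..d}" "\<tau> permutes {1..d}" "f \<in> G_objs l d"
  shows "mat_char d (powers_mat d \<sigma> c) (f, \<tau>, g) = (if \<sigma> = \<tau> then kern d c f else 0)"
  using mat_char_mono_mat[OF assms] by (simp add: kern_def power_mult)

lemma fourier_powers_mat:
  assumes a: "a \<in> carrier (group_algebra (S_group l d))"
    and \<sigma>: "\<sigma> permutes {1..d}" and f: "f \<in> G_objs l d"
  shows "fourier l d a (f, \<sigma>, f \<circ> inv' \<sigma>) = (\<Sum>c\<in>G_objs l d. a (powers_mat d \<sigma> c) * kern d c f)"
proof -
  let ?m = "(f, \<sigma>, f \<circ> inv' \<sigma>)"
  have "fourier l d a ?m = (\<Sum>M\<in>carrier (S_group l d). a M * mat_char d M ?m)"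
    using a G_groupoid_Mor_I[OF f \<sigma>] by (simp add: fourier_apply)
  also have "\<dots> = (\<Sum>(\<tau>, c)\<in>{\<tau>. \<tau> permutes {1..d}} \<times> G_objs l d.
      a (powers_mat d \<tau> c) * mat_char d (powers_mat d \<tau> c) ?m)"
    by (subst sum.reindex_bij_betw[OF bij_betw_powers_mat, symmetric]) (simp add: split_def)
  also have "\<dots> = (\<Sum>\<tau> | \<tau> permutes {1..d}. \<Sum>c\<in>G_objs l d.
      a (powers_mat d \<tau> c) * mat_char d (powers_mat d \<tau> c) ?m)"
    by (simp add: sum.cartesian_product)
  also have "\<dots> = (\<Sum>\<tau> | \<tau> permutes {1..d}. if \<tau> = \<sigma> then
      \<Sum>c\<in>G_objs l d. a (powers_mat d \<sigma> c) * kern d c f else 0)"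
    using \<sigma> f by (intro sum.cong refl) (auto simp: mat_char_powers_mat)
  also have "\<dots> = (\<Sum>c\<in>G_objs l d. a (powers_mat d \<sigma> c) * kern d c f)"
    using \<sigma> by (simp add: finite_permutations)
  finally show ?thesis .
qed

text \<open>Recovers the coefficients from the transform; this is what makes \<open>fourier\<close>
  injective.\<close>

lemma kern_inversion:
  assumes "e \<in> G_objs l d"
  shows "(\<Sum>f\<in>G_objs l d. (\<Sum>c\<in>G_objs l d. u c * kern d c f) * inverse (kern d e f)) = of_nat l ^ d * u e"
proof -
  have "(\<Sum>f\<in>G_objs l d. (\<Sum>c\<in>G_objs l d. u c * kern d c f) * inverse (kern d e f)) =
      (\<Sum>f\<in>G_objs l d. \<Sum>c\<in>G_objs l d. u c * (kern d c f * inverse (kern d e f)))"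
    by (simp add: sum_distrib_right mult.assoc)
  also have "\<dots> = (\<Sum>c\<in>G_objs l d. u c * (\<Sum>f\<in>G_objs l d. kern d c f * inverse (kern d e f)))"
    by (subst sum.swap) (simp add: sum_distrib_left)
  also have "\<dots> = (\<Sum>c\<in>G_objs l d. if c = e then of_nat l ^ d * u e else 0)"
    using assms by (intro sum.cong refl) (auto simp: kern_orthogonal)
  finally show ?thesis using assms by simp
qed

text \<open>The same orthogonality with frequency and argument exchanged through
  \<open>kern_commute\<close>; it shows that the inverse transform is a preimage, hence surjectivity
  of \<open>fourier\<close>.\<close>

lemma kern_inversion':
  assumes "e \<in> G_objs l d"
  shows "(\<Sum>c\<in>G_objs l d. (\<Sum>f\<in>G_objs l d. u f * inverse (kern d c f)) * kern d c e) = of_nat l ^ d * u e"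
proof -
  have comm: "u f * inverse (kern d c f) * kern d c e = u f * (kern d e c * inverse (kern d f c))" for c f
    by (simp add: kern_commute[of d c e] kern_commute[of d c f])
  have "(\<Sum>c\<in>G_objs l d. (\<Sum>f\<in>G_objs l d. u f * inverse (kern d c f)) * kern d c e) =
      (\<Sum>c\<in>G_objs l d. \<Sum>f\<in>G_objs l d. u f * (kern d e c * inverse (kern d f c)))"
    by (simp only: sum_distrib_right comm)
  also have "\<dots> = (\<Sum>f\<in>G_objs l d. u f * (\<Sum>c\<in>G_objs l d. kern d e c * inverse (kern d f c)))"
    by (subst sum.swap) (simp add: sum_distrib_left)
  also have "\<dots> = (\<Sum>f\<in>G_objs l d. if f = e then of_nat l ^ d * u e else 0)"
    using assms by (intro sum.cong refl) (auto simp: kern_orthogonal)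
  finally show ?thesis using assms by simp
qed

lemma fourier_bij:
  "bij_betw (fourier l d) (carrier (group_algebra (S_group l d))) (carrier (A_alg l d))"
proof (rule bij_betw_imageI)
  let ?R = "carrier (group_algebra (S_group l d))"
  have lnz: "of_nat l ^ d \<noteq> (0 :: complex)" using l_pos by simp
  show "inj_on (fourier l d) ?R"
  proof (rule inj_onI)
    fix a b assume a: "a \<in> ?R" and b: "b \<in> ?R" and eq: "fourier l d a = fourier l d b"
    have "a M = b M" if M_S: "M \<in> carrier (S_group l d)" for M
    proof -
      obtain \<sigma> e where M: "\<sigma> permutes {1..d}" "e \<in> G_objs l d" "M = powers_mat d \<sigma> e"
        by (rule S_group_imp_powers_mat[OF M_S]) blast
      have "(\<Sum>c\<in>G_objs l d. a (powers_mat d \<sigma> c) * kern d c f) =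
          (\<Sum>c\<in>G_objs l d. b (powers_mat d \<sigma> c) * kern d c f)" if "f \<in> G_objs l d" for f
        using fourier_powers_mat[OF a M(1) that] fourier_powers_mat[OF b M(1) that] eq by simp
      then have "of_nat l ^ d * a M = of_nat l ^ d * b M"
        unfolding M(3) kern_inversion[OF M(2), symmetric, of "\<lambda>c. a (powers_mat d \<sigma> c)"]
          kern_inversion[OF M(2), symmetric, of "\<lambda>c. b (powers_mat d \<sigma> c)"] by simp
      then show ?thesis using lnz l_pos by simp
    qed
    moreover have "a M = b M" if "M \<notin> carrier (S_group l d)" for M
      using a b that by (simp add: group_algebra_S_carrier)
    ultimately show "a = b" by blast
  qed
  have "u \<in> fourier l d ` ?R" if u: "u \<in> carrier (A_alg l d)" for u
  proof -
    \<comment> \<open>The inverse transform of \<open>u\<close>, taken separately for each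
      permutation.\<close>
    define v where "v \<sigma> c = (\<Sum>f\<in>G_objs l d. u (f, \<sigma>, f \<circ> inv' \<sigma>) * inverse (kern d c f)) / of_nat l ^ d" for \<sigma> c
    \<comment> \<open>\<open>inv_into\<close> reads off the permutation and the exponents of
      \<open>M\<close>, at which \<open>v\<close> is then evaluated.\<close>
    define a where "a M = (if M \<in> carrier (S_group l d)
      then case_prod v (inv_into ({\<sigma>. \<sigma> permutes {1..d}} \<times> G_objs l d) (\<lambda>(\<sigma>, c). powers_mat d \<sigma> c) M) else 0)" for M
    have a_R: "a \<in> ?R" by (simp add: group_algebra_S_carrier a_def)
    have a_mat: "a (powers_mat d \<sigma> c) = v \<sigma> c" if "\<sigma> permutes {1..d}" "c \<in> G_objs l d" for \<sigma> c
    proof -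
      have "inv_into ({\<sigma>. \<sigma> permutes {1..d}} \<times> G_objs l d) (\<lambda>(\<sigma>, c). powers_mat d \<sigma> c) (powers_mat d \<sigma> c) = (\<sigma>, c)"
        using inv_into_f_f[OF bij_betw_imp_inj_on[OF bij_betw_powers_mat[of d]], of "(\<sigma>, c)"] that by simp
      then show ?thesis using powers_mat_in_S_group[OF that(1)] by (simp add: a_def)
    qed
    have "fourier l d a m = u m" for m
    proof (cases "m \<in> Mor (G_groupoid l d)")
      case False
      then have "u m = 0" using u unfolding A_alg_carrier by blast
      then show ?thesis using False a_R by (simp add: fourier_apply)
    next
      case True
      then obtain f \<sigma> where m: "m = (f, \<sigma>, f \<circ> inv' \<sigma>)" and f: "f \<in> G_objs l d" and \<sigma>: "\<sigma> permutes {1..d}"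
        by (metis G_groupoid_Mor_iff prod.exhaust)
      have "fourier l d a m = (\<Sum>c\<in>G_objs l d. v \<sigma> c * kern d c f)"
        unfolding m fourier_powers_mat[OF a_R \<sigma> f] using a_mat[OF \<sigma>] by simp
      also have "\<dots> = (\<Sum>c\<in>G_objs l d. (\<Sum>f\<in>G_objs l d. u (f, \<sigma>, f \<circ> inv' \<sigma>) * inverse (kern d c f)) * kern d c f) / of_nat l ^ d"
        unfolding sum_divide_distrib[of "\<lambda>c. _ c * kern d c f"] v_def times_divide_eq_left by (rule refl)
      also have "\<dots> = u m"
        unfolding kern_inversion'[OF f, of "\<lambda>f. u (f, \<sigma>, f \<circ> inv' \<sigma>)"] m using lnz by simp
      finally show ?thesis .
    qed
    then show ?thesis using a_R by (intro image_eqI[of _ _ a]) auto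
  qed
  then show "fourier l d ` ?R = carrier (A_alg l d)"
    by (auto simp: A_alg_carrier fourier_apply)
qed

text \<open>Powers of \<open>s0_matrix\<close> give every root in the first diagonal place,
  conjugation by transpositions moves it to any place, and products of these give all diagonal
  matrices. Inverses need no separate case, as non-negative powers of \<open>xi\<close> already give
  all roots.\<close>

lemma S_group_generated [consumes 2, case_names mult perm s0]:
  assumes M: "M \<in> carrier (S_group l d)" and "d > 0"
    and mult: "\<And>M N. M \<in> carrier (S_group l d) \<Longrightarrow> N \<in> carrier (S_group l d) \<Longrightarrow> Q M \<Longrightarrow> Q N \<Longrightarrow> Q (M * N)"
    and perm: "\<And>\<sigma>. \<sigma> permutes {1..d} \<Longrightarrow> Q (perm_matrix d \<sigma>)"
    and s0: "Q (s0_matrix d xi)"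
  shows "Q M"
proof -
  define R where "R = {M \<in> carrier (S_group l d). Q M}"
  have R_mult: "M * N \<in> R" if "M \<in> R" "N \<in> R" for M N
    using that mult S_group_mult_closed[OF l_pos] by (auto simp: R_def)
  have R_perm: "mono_mat d \<sigma> (\<lambda>_. 1) \<in> R" if "\<sigma> permutes {1..d}" for \<sigma>
    using perm[OF that] powers_mat_in_S_group[OF that, of "\<lambda>_. 0"] by (simp add: R_def perm_matrix_eq_mono_mat)
  have "s0_matrix d xi = powers_mat d id (\<lambda>j. if j = 1 then 1 else 0)"
    unfolding s0_matrix_eq_mono_mat by (rule mono_mat_cong) auto
  then have R_s0: "s0_matrix d xi \<in> R"
    using s0 powers_mat_in_S_group[of id d] by (simp add: R_def permutes_id)
  have first: "powers_mat d id (\<lambda>j. if j = 1 then n else 0) \<in> R" for n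
  proof (induction n)
    case 0
    have "powers_mat d id (\<lambda>j. if j = 1 then 0 else 0) = mono_mat d id (\<lambda>_. 1)"
      by (rule mono_mat_cong) auto
    then show ?case using R_perm[OF permutes_id] by metis
  next
    case (Suc n)
    have "s0_matrix d xi * powers_mat d id (\<lambda>j. if j = 1 then n else 0) =
        powers_mat d id (\<lambda>j. if j = 1 then Suc n else 0)"
      unfolding s0_matrix_eq_mono_mat mono_mat_mult[OF permutes_id] by (auto intro: mono_mat_cong)
    then show ?case using R_mult[OF R_s0 Suc] by metis
  qed
  have single: "powers_mat d id (\<lambda>j. if j = i then n else 0) \<in> R" if i: "i \<in> {1..d}" for i n
  proof -
    \<comment> \<open>An involution, so the same matrix serves on both sides of the
      conjugation.\<close>
    define \<tau> where "\<tau> = transpose 1 i"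
    have \<tau>: "\<tau> permutes {1..d}" using i \<open>d > 0\<close> by (simp add: \<tau>_def permutes_swap_id)
    have \<tau>1: "\<tau> j = Suc 0 \<longleftrightarrow> j = i" for j by (auto simp: \<tau>_def transpose_def)
    have \<tau>\<tau>: "\<tau> \<circ> \<tau> = id" by (simp add: \<tau>_def)
    have "mono_mat d \<tau> (\<lambda>_. 1) * powers_mat d id (\<lambda>j. if j = 1 then n else 0) * mono_mat d \<tau> (\<lambda>_. 1)
        = powers_mat d id (\<lambda>j. if j = i then n else 0)"
      unfolding mono_mat_mult[OF permutes_id] mono_mat_mult[OF \<tau>]
      by (simp add: \<tau>1 \<tau>\<tau>)
    then show ?thesis using R_mult[OF R_mult[OF R_perm[OF \<tau>] first[of n]] R_perm[OF \<tau>]] by simp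
  qed
  \<comment> \<open>The diagonal is filled one place at a time; places beyond \<open>m\<close> keep
    exponent 0, that is, entry 1.\<close>
  have diag: "m \<le> d \<Longrightarrow> powers_mat d id (\<lambda>j. if j \<le> m then c j else 0) \<in> R" for m c
  proof (induction m)
    case 0
    have "powers_mat d id (\<lambda>j. if j \<le> 0 then c j else 0) = mono_mat d id (\<lambda>_. 1)"
      by (rule mono_mat_cong) auto
    then show ?case using R_perm[OF permutes_id] by metis
  next
    case (Suc m)
    have "powers_mat d id (\<lambda>j. if j \<le> m then c j else 0) * powers_mat d id (\<lambda>j. if j = Suc m then c (Suc m) else 0)
        = powers_mat d id (\<lambda>j. if j \<le> Suc m then c j else 0)"
      unfolding mono_mat_mult[OF permutes_id] by (auto intro!: mono_mat_cong simp: le_Suc_eq)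
    then show ?case using R_mult[OF Suc.IH single[of "Suc m" "c (Suc m)"]] Suc.prems by (simp add: id_def)
  qed
  obtain \<sigma> c where \<sigma>: "\<sigma> permutes {1..d}" and M_eq: "M = powers_mat d \<sigma> c"
    by (rule S_group_imp_powers_mat[OF M]) blast
  have "mono_mat d \<sigma> (\<lambda>_. 1) * powers_mat d id (\<lambda>j. if j \<le> d then c j else 0) = M"
    unfolding mono_mat_mult[OF permutes_id] M_eq by (auto intro: mono_mat_cong)
  then show "Q M" using R_mult[OF R_perm[OF \<sigma>] diag[of d c]] by (simp add: R_def)
qed

section \<open>Identification of Phi with the transform\<close>

lemma fourier_perm_matrix:
  assumes \<sigma>: "\<sigma> permutes {1..d}"
  shows "fourier l d (basis_elt (perm_matrix d \<sigma>)) =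
    (\<lambda>m. \<Sum>f\<in>G_objs l d. \<Sum>g\<in>G_objs l d. perm_arrow \<sigma> f g m)"
proof
  fix m :: mor
  obtain f' \<tau> g' where m: "m = (f', \<tau>, g')" by (metis prod.exhaust)
  have "(\<Sum>f\<in>G_objs l d. \<Sum>g\<in>G_objs l d. perm_arrow \<sigma> f g m) =
      (\<Sum>f\<in>G_objs l d. if f = f' then \<Sum>g\<in>G_objs l d. if g = g' then
        (if g' \<circ> \<sigma> = f' \<and> \<tau> = \<sigma> then 1 else 0) else 0 else 0)"
  proof (rule sum.cong[OF refl])
    fix f
    have "perm_arrow \<sigma> f g m = (if f = f' then if g = g' then
        (if g' \<circ> \<sigma> = f' \<and> \<tau> = \<sigma> then 1 else 0) else 0 else 0)" for g
      by (auto simp: m perm_arrow_def basis_elt_def)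
    then show "(\<Sum>g\<in>G_objs l d. perm_arrow \<sigma> f g m) =
        (if f = f' then \<Sum>g\<in>G_objs l d. if g = g' then
          (if g' \<circ> \<sigma> = f' \<and> \<tau> = \<sigma> then 1 else 0) else 0 else 0)"
      by simp
  qed
  also have "\<dots> = (if m \<in> Mor (G_groupoid l d) \<and> \<tau> = \<sigma> then 1 else 0)"
    using \<sigma> by (auto simp: m G_groupoid_def)
  also have "\<dots> = (if m \<in> Mor (G_groupoid l d) then mat_char d (perm_matrix d \<sigma>) m else 0)"
    unfolding perm_matrix_eq_mono_mat m
    using mat_char_mono_mat[OF \<sigma>, of \<tau> f' l "\<lambda>_. 1" g'] by (auto simp: G_groupoid_Mor_iff)
  also have "\<dots> = fourier l d (basis_elt (perm_matrix d \<sigma>)) m"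
    using powers_mat_in_S_group[OF \<sigma>, of "\<lambda>_. 0"]
    by (simp add: fourier_basis_elt[OF l_pos] perm_matrix_eq_mono_mat)
  finally show "fourier l d (basis_elt (perm_matrix d \<sigma>)) m =
    (\<Sum>f\<in>G_objs l d. \<Sum>g\<in>G_objs l d. perm_arrow \<sigma> f g m)" by simp
qed

lemma s0_matrix_in_S_group: "s0_matrix d xi \<in> carrier (S_group l d)"
  unfolding s0_matrix_eq_mono_mat using l_pos generator_power_in_roots[of 1] generator_power_in_roots[of 0]
  by (intro mono_mat_in_S_group) (auto simp: permutes_id)

text \<open>Only place 1 contributes a factor other than 1 to the character; it occurs in the
  product because \<open>d > 0\<close>.\<close>

lemma fourier_s0_matrix:
  assumes "d > 0"
  shows "fourier l d (basis_elt (s0_matrix d xi)) =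
    (\<lambda>m. \<Sum>f\<in>G_objs l d. xi ^ f 1 * basis_elt (Idm (G_groupoid l d) f) m)"
proof
  fix m :: mor
  obtain f' \<tau> g' where m: "m = (f', \<tau>, g')" by (metis prod.exhaust)
  have "(\<Sum>f\<in>G_objs l d. xi ^ f 1 * basis_elt (Idm (G_groupoid l d) f) m) =
      (\<Sum>f\<in>G_objs l d. if f = f' then (if \<tau> = id \<and> g' = f' then xi ^ f' 1 else 0) else 0)"
    by (intro sum.cong refl) (auto simp: m basis_elt_def)
  also have "\<dots> = (if m \<in> Mor (G_groupoid l d) \<and> \<tau> = id then xi ^ f' 1 else 0)"
    by (auto simp: m G_groupoid_Mor_iff)
  also have "\<dots> = (if m \<in> Mor (G_groupoid l d) then mat_char d (s0_matrix d xi) m else 0)"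
  proof -
    have "(\<Prod>j\<in>{1..d}. (if j = 1 then xi else 1) ^ f' j) = (\<Prod>j\<in>{1..d}. if j = 1 then xi ^ f' 1 else 1)"
      by (rule prod.cong) auto
    also have "\<dots> = xi ^ f' 1" using assms by simp
    finally show ?thesis
      unfolding s0_matrix_eq_mono_mat m
      using mat_char_mono_mat[OF permutes_id, where d = d and l = l and f = f' and \<tau> = \<tau> and g = g'
          and a = "\<lambda>j. if j = 1 then xi else 1"]
      by (auto simp: G_groupoid_Mor_iff)
  qed
  also have "\<dots> = fourier l d (basis_elt (s0_matrix d xi)) m"
    using fourier_basis_elt[OF l_pos s0_matrix_in_S_group] by simp
  finally show "fourier l d (basis_elt (s0_matrix d xi)) m =
    (\<Sum>f\<in>G_objs l d. xi ^ f 1 * basis_elt (Idm (G_groupoid l d) f) m)" by simp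
qed

text \<open>A second candidate has the same values on the generators, hence by multiplicativity on
  all group elements and by linearity on the whole algebra; extensionality settles the remaining
  arguments.\<close>

lemma Phi_eq_fourier:
  assumes "d > 0"
  shows "Phi l d xi = fourier l d"
  unfolding Phi_def
proof (rule the_equality)
  let ?R = "group_algebra (S_group l d)"
  have hom: "fourier l d \<in> algebra_hom ?R (A_alg l d)" by (rule fourier_algebra_hom[OF l_pos])
  show Phi: "is_Phi l d xi (fourier l d)"
    unfolding is_Phi_def algebra_iso_def
    using hom fourier_bij[of d] fourier_perm_matrix fourier_s0_matrix[OF assms]
    by (simp add: fourier_def)
  fix \<phi> assume \<phi>: "is_Phi l d xi \<phi>"
  then have \<phi>_hom: "\<phi> \<in> algebra_hom ?R (A_alg l d)" by (simp add: is_Phi_def algebra_iso_def)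
  have basis_R: "basis_elt M \<in> carrier ?R" if "M \<in> carrier (S_group l d)" for M
    using that by (simp add: group_algebra_def basis_elt_in_carrier)
  have basis_mult: "basis_elt (M * N) = basis_elt M \<otimes>\<^bsub>?R\<^esub> basis_elt N"
    if "M \<in> carrier (S_group l d)" "N \<in> carrier (S_group l d)" for M N
  proof
    fix x
    let ?T = "{(p, q). p \<in> carrier (S_group l d) \<and> q \<in> carrier (S_group l d) \<and> p * q = x}"
    have fin: "finite ?T"
      by (rule finite_subset[of _ "carrier (S_group l d) \<times> carrier (S_group l d)"])
        (auto simp: finite_S_group[OF l_pos])
    have "(basis_elt M \<otimes>\<^bsub>?R\<^esub> basis_elt N) x = (\<Sum>r\<in>?T. if r = (M, N) then 1 else 0)"
      unfolding group_algebra_S_mult by (rule sum.cong) (auto simp: basis_elt_def split: if_splits)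
    then show "basis_elt (M * N) x = (basis_elt M \<otimes>\<^bsub>?R\<^esub> basis_elt N) x"
      using fin that by (simp add: basis_elt_def)
  qed
  have basis: "\<phi> (basis_elt M) = fourier l d (basis_elt M)" if "M \<in> carrier (S_group l d)" for M
    using that assms
  proof (induction M rule: S_group_generated)
    case (mult M N)
    have "\<chi> (basis_elt (M * N)) = \<chi> (basis_elt M) \<otimes>\<^bsub>A_alg l d\<^esub> \<chi> (basis_elt N)"
      if "\<chi> \<in> algebra_hom ?R (A_alg l d)" for \<chi>
      using that basis_R[OF mult(1)] basis_R[OF mult(2)] unfolding basis_mult[OF mult(1,2)]
      by (simp add: algebra_hom_def ring_hom_def)
    from this[OF \<phi>_hom] this[OF hom] show ?case using mult by simp
  next
    case (perm \<sigma>)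
    then show ?case using \<phi> Phi by (simp add: is_Phi_def)
  next
    case s0
    then show ?case using \<phi> Phi by (simp add: is_Phi_def)
  qed
  show "\<phi> = fourier l d"
  proof (rule extensionalityI)
    show "\<phi> \<in> extensional (carrier ?R)" using \<phi> by (simp add: is_Phi_def)
    show "fourier l d \<in> extensional (carrier ?R)" by (simp add: fourier_def)
    show "\<phi> a = fourier l d a" if "a \<in> carrier ?R" for a
      using algebra_hom_eqI[OF finite_S_group[OF l_pos] \<phi>_hom[unfolded group_algebra_def A_alg_def groupoid_algebra_def]
          hom[unfolded group_algebra_def A_alg_def groupoid_algebra_def] basis that[unfolded group_algebra_def]] .
  qed
qed

end

section \<open>The cyclic action and the quotient groupoid\<close>

lemma mod_eq_imp_eq_interval:
  fixes x y l :: nat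
  assumes "x \<in> {1..l}" "y \<in> {1..l}" "x mod l = y mod l"
  shows "x = y"
proof -
  have "z mod l = (if z = l then 0 else z)" if "z \<in> {1..l}" for z using that by auto
  with assms show ?thesis by (auto split: if_splits)
qed

lemma theta_shift:
  assumes "x \<in> {1..l}"
  shows "theta l x \<in> {1..l}" "theta l x mod l = (x + 1) mod l"
  using assms by (auto simp: theta_def mod_Suc)

locale cyclic_action =
  fixes l k d :: nat
  assumes l_pos: "l > 0" and d_pos: "d > 0"
begin

lemma theta_permutes: "theta l permutes {1..l}"
proof (rule bij_imp_permutes)
  have "inj_on (theta l) {1..l}"
    by (rule inj_onI) (auto simp: theta_def split: if_splits)
  moreover have "theta l ` {1..l} \<subseteq> {1..l}" using theta_shift(1) by blast
  ultimately show "bij_betw (theta l) {1..l} {1..l}"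
    by (simp add: bij_betw_def endo_inj_surj)
qed (use l_pos in \<open>auto simp: theta_def\<close>)

lemma theta_pow_permutes: "(theta l ^^ n) permutes {1..l}"
proof (induction n)
  case 0
  then show ?case by (metis funpow_0 id_apply permutes_id eq_id_iff)
next
  case (Suc n)
  then show ?case unfolding funpow.simps by (intro permutes_compose theta_permutes)
qed

lemma theta_pow_shift:
  assumes "x \<in> {1..l}"
  shows "(theta l ^^ n) x mod l = (x + n) mod l"
proof (induction n)
  case (Suc n)
  have "(theta l ^^ n) x \<in> {1..l}" using permutes_in_image[OF theta_pow_permutes] assms by blast
  then show ?case using theta_shift(2)[of "(theta l ^^ n) x" l] Suc
    by simp (metis mod_Suc_eq)
qed simp

lemma H_group_permutes:
  assumes "h \<in> H_group l k"
  shows "h permutes {1..l}"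
  using group.generate_in_carrier[OF sym_group_is_group, of "{theta l ^^ (l div k)}" l h] assms
    theta_pow_permutes[of "l div k"]
  by (simp add: H_group_def sym_group_carrier)

lemma subgroup_H_group: "subgroup (H_group l k) (sym_group l)"
  unfolding H_group_def
  by (rule group.generate_is_subgroup[OF sym_group_is_group])
    (use theta_pow_permutes[of "l div k"] in \<open>simp add: sym_group_carrier\<close>)

lemma H_group_id [simp]: "id \<in> H_group l k"
  using subgroup.one_closed[OF subgroup_H_group] by (simp add: sym_group_one)

lemma H_group_comp: "h \<in> H_group l k \<Longrightarrow> h' \<in> H_group l k \<Longrightarrow> h \<circ> h' \<in> H_group l k"
  using subgroup.m_closed[OF subgroup_H_group] by (simp add: sym_group_mult)

lemma H_group_inv: "h \<in> H_group l k \<Longrightarrow> inv' h \<in> H_group l k"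
  using subgroup.m_inv_closed[OF subgroup_H_group, of h] H_group_permutes[of h]
  by (simp add: sym_group_carrier)

lemma theta_pow_in_H_group: "theta l ^^ (l div k) \<in> H_group l k"
  unfolding H_group_def by (rule generate.incl) simp

lemma finite_H_group: "finite (H_group l k)"
  by (rule finite_subset[of _ "{h. h permutes {1..l}}"]) (auto simp: finite_permutations dest: H_group_permutes)

text \<open>Induction over the generated subgroup: its elements act as translations modulo
  \<open>l\<close>, and the admissible step sizes \<open>c\<close> are closed under addition and
  negation.\<close>

lemma H_group_shift:
  assumes "h \<in> H_group l k"
  obtains c where "(l div k) dvd c" "\<And>x. x \<in> {1..l} \<Longrightarrow> h x mod l = (x + c) mod l"
proof -
  let ?t = "theta l ^^ (l div k)"
  have "\<exists>c. (l div k) dvd c \<and> (\<forall>x\<in>{1..l}. h x mod l = (x + c) mod l)"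
    using assms unfolding H_group_def
  proof (induction h rule: generate.induct)
    case one
    then show ?case by (intro exI[of _ 0]) (simp add: sym_group_one)
  next
    case (incl h)
    then show ?case using theta_pow_shift by (intro exI[of _ "l div k"]) auto
  next
    case (inv h)
    then have h: "h = ?t" by simp
    \<comment> \<open>The factor \<open>l - 1\<close> stands for -1 modulo \<open>l\<close>, so the
      inverse is again a translation by a natural number.\<close>
    have "inv' ?t x mod l = (x + (l div k) * (l - 1)) mod l" if x: "x \<in> {1..l}" for x
    proof -
      define y where "y = inv' ?t x"
      have y: "y \<in> {1..l}" unfolding y_def using permutes_in_image[OF permutes_inv[OF theta_pow_permutes]] x by blast
      have "?t y = x" unfolding y_def using permutes_inverses(1)[OF theta_pow_permutes] by simp
      then have "x mod l = (y + l div k) mod l" using theta_pow_shift[OF y, of "l div k"] by simp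
      then have "(x + (l div k) * (l - 1)) mod l = (y + l div k + (l div k) * (l - 1)) mod l"
        by (rule mod_add_cong) simp
      also have "y + l div k + (l div k) * (l - 1) = y + (l div k) * l"
        using x by (cases l) (auto simp: algebra_simps)
      finally show ?thesis by (simp add: y_def)
    qed
    moreover have "inv\<^bsub>sym_group l\<^esub> h = inv' ?t"
      unfolding h using theta_pow_permutes[of "l div k"]
      by (intro sym_group_inv_equality) (simp add: sym_group_carrier)
    ultimately show ?case by (intro exI[of _ "(l div k) * (l - 1)"]) simp
  next
    case (eng h1 h2)
    then obtain c1 c2 where c: "(l div k) dvd c1" "\<And>x. x \<in> {1..l} \<Longrightarrow> h1 x mod l = (x + c1) mod l"
      "(l div k) dvd c2" "\<And>x. x \<in> {1..l} \<Longrightarrow> h2 x mod l = (x + c2) mod l" by blast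
    have h2: "h2 permutes {1..l}" using eng(2) by (intro H_group_permutes) (simp add: H_group_def)
    have "(h1 \<circ> h2) x mod l = (x + (c2 + c1)) mod l" if x: "x \<in> {1..l}" for x
    proof -
      have "h2 x \<in> {1..l}" using permutes_in_image[OF h2] x by blast
      then have "(h1 \<circ> h2) x mod l = (h2 x + c1) mod l" using c(2) by simp
      also have "\<dots> = (x + c2 + c1) mod l" using c(4)[OF x] by (rule mod_add_cong) simp
      finally show ?thesis by (simp add: add.assoc)
    qed
    then show ?case using c by (intro exI[of _ "c2 + c1"]) (simp add: sym_group_mult)
  qed
  then show ?thesis using that by blast
qed

text \<open>A translation that fixes one residue has a step size divisible by \<open>l\<close>,
  hence fixes all of them.\<close>

lemma H_group_fixed_point_free:
  assumes h: "h \<in> H_group l k" and x: "x \<in> {1..l}" and "h x = x"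
  shows "h = id"
proof
  fix y
  obtain c where c: "\<And>x. x \<in> {1..l} \<Longrightarrow> h x mod l = (x + c) mod l"
    using H_group_shift[OF h] by metis
  have "x mod l = (x + c) mod l" using c[OF x] assms(3) by simp
  then have "l dvd c" using mod_eq_dvd_iff_nat[of x "x + c" l] by auto
  show "h y = id y"
  proof (cases "y \<in> {1..l}")
    case True
    moreover have "h y \<in> {1..l}" using True permutes_in_image[OF H_group_permutes[OF h]] by blast
    moreover have "h y mod l = y mod l" using c[OF True] \<open>l dvd c\<close> by auto
    ultimately show ?thesis by (auto intro: mod_eq_imp_eq_interval)
  next
    case False
    then show ?thesis using permutes_not_in[OF H_group_permutes[OF h]] by simp
  qed
qed

section \<open>The free action on objects and morphisms\<close>

lemma act_obj_in:
  assumes "h \<in> H_group l k" "f \<in> G_objs l d"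
  shows "act_obj d h f \<in> G_objs l d"
  using assms permutes_in_image[OF H_group_permutes[OF assms(1)]]
  unfolding act_obj_def G_objs_def compose_def by (auto simp: PiE_iff)

lemma act_obj_id: "f \<in> G_objs l d \<Longrightarrow> act_obj d id f = f"
  unfolding act_obj_def G_objs_def compose_def by (auto simp: fun_eq_iff PiE_iff extensional_def)

lemma act_obj_comp: "act_obj d h (act_obj d h' f) = act_obj d (h \<circ> h') f"
  unfolding act_obj_def compose_def by auto

lemma act_mor_in:
  assumes h: "h \<in> H_group l k" and m: "m \<in> Mor (G_groupoid l d)"
  shows "act_mor d h m \<in> Mor (G_groupoid l d)"
proof -
  obtain f \<sigma> g where fg: "m = (f, \<sigma>, g)" "f \<in> G_objs l d" "g \<in> G_objs l d" "\<sigma> permutes {1..d}" "g \<circ> \<sigma> = f"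
    using m by (auto simp: G_groupoid_def)
  have "act_obj d h g \<circ> \<sigma> = act_obj d h f"
    using fg(5) permutes_in_image[OF fg(4)]
    by (auto simp: act_obj_def compose_def fun_eq_iff)
  then show ?thesis using fg act_obj_in[OF h] by (simp add: act_mor_def G_groupoid_def)
qed

lemma act_mor_id: "m \<in> Mor (G_groupoid l d) \<Longrightarrow> act_mor d id m = m"
  by (auto simp: act_mor_def G_groupoid_def act_obj_id)

lemma act_mor_comp: "act_mor d h (act_mor d h' m) = act_mor d (h \<circ> h') m"
  by (auto simp: act_mor_def act_obj_comp split: prod.splits)

lemma act_mor_Src: "Src (G_groupoid l d) (act_mor d h m) = act_obj d h (Src (G_groupoid l d) m)"
  and act_mor_Tgt: "Tgt (G_groupoid l d) (act_mor d h m) = act_obj d h (Tgt (G_groupoid l d) m)"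
  and act_mor_Idm: "act_mor d h (Idm (G_groupoid l d) f) = Idm (G_groupoid l d) (act_obj d h f)"
  and act_mor_Cmp: "Cmp (G_groupoid l d) (act_mor d h p) (act_mor d h q) = act_mor d h (Cmp (G_groupoid l d) p q)"
  by (cases m; cases p; cases q; simp add: act_mor_def)+

lemma G_groupoid_Src_Cmp: "Src (G_groupoid l d) (Cmp (G_groupoid l d) p q) = Src (G_groupoid l d) q"
  and G_groupoid_Tgt_Cmp: "Tgt (G_groupoid l d) (Cmp (G_groupoid l d) p q) = Tgt (G_groupoid l d) p"
  by (cases p; cases q; simp)+

lemma G_groupoid_Src_in: "m \<in> Mor (G_groupoid l d) \<Longrightarrow> Src (G_groupoid l d) m \<in> G_objs l d"
  and G_groupoid_Tgt_in: "m \<in> Mor (G_groupoid l d) \<Longrightarrow> Tgt (G_groupoid l d) m \<in> G_objs l d"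
  by (auto simp: G_groupoid_def)

text \<open>It suffices to look at the value at 1, which belongs to \<open>{1..d}\<close> since
  \<open>d > 0\<close>: there \<open>h\<close> and \<open>h'\<close> agree, so their quotient has a
  fixed point.\<close>

lemma act_obj_free:
  assumes f: "f \<in> G_objs l d" and h: "h \<in> H_group l k" "h' \<in> H_group l k"
    and eq: "act_obj d h f = act_obj d h' f"
  shows "h = h'"
proof -
  have h': "h' permutes {1..l}" by (rule H_group_permutes[OF h(2)])
  have one: "1 \<in> {1..d}" using d_pos by simp
  have "h (f 1) = h' (f 1)" using fun_cong[OF eq, of 1] one by (simp add: act_obj_def compose_def)
  then have "(inv' h' \<circ> h) (f 1) = f 1" using permutes_inverses(2)[OF h'] by simp
  then have "inv' h' \<circ> h = id"
    using H_group_fixed_point_free[OF H_group_comp[OF H_group_inv[OF h(2)] h(1)] G_objs_range(1)[OF f one]] by simp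
  then show "h = h'" using permutes_inv_o(1)[OF h'] by (metis comp_assoc comp_id id_comp)
qed

text \<open>An element of the group fixing the source is the identity. Hence an orbit contains at
  most one morphism with a given source, which is the uniqueness of lifts.\<close>

lemma act_mor_free_Src:
  assumes "m \<in> Mor (G_groupoid l d)" "h \<in> H_group l k"
    and "Src (G_groupoid l d) (act_mor d h m) = Src (G_groupoid l d) m"
  shows "act_mor d h m = m"
proof -
  have "h = id"
    using act_obj_free[OF G_groupoid_Src_in[OF assms(1)] assms(2) H_group_id] assms(3)
      act_obj_id[OF G_groupoid_Src_in[OF assms(1)]] by (simp add: act_mor_Src)
  then show ?thesis using act_mor_id[OF assms(1)] by simp
qed

lemma act_mor_free_Tgt:
  assumes "m \<in> Mor (G_groupoid l d)" "h \<in> H_group l k"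
    and "Tgt (G_groupoid l d) (act_mor d h m) = Tgt (G_groupoid l d) m"
  shows "act_mor d h m = m"
proof -
  have "h = id"
    using act_obj_free[OF G_groupoid_Tgt_in[OF assms(1)] assms(2) H_group_id] assms(3)
      act_obj_id[OF G_groupoid_Tgt_in[OF assms(1)]] by (simp add: act_mor_Tgt)
  then show ?thesis using act_mor_id[OF assms(1)] by simp
qed

lemma orbit_mor_self: "m \<in> Mor (G_groupoid l d) \<Longrightarrow> m \<in> orbit_mor l k d m"
  unfolding orbit_mor_def using act_mor_id H_group_id by (metis image_eqI)

lemma orbit_obj_self: "f \<in> G_objs l d \<Longrightarrow> f \<in> orbit_obj l k d f"
  unfolding orbit_obj_def using act_obj_id H_group_id by (metis image_eqI)

section \<open>Orbits and composition in the quotient\<close>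

lemma H_group_right_translation:
  assumes h: "h \<in> H_group l k"
  shows "(\<lambda>g. g \<circ> h) ` H_group l k = H_group l k"
proof (intro equalityI subsetI)
  fix g assume g: "g \<in> H_group l k"
  have "g = (g \<circ> inv' h) \<circ> h"
    using permutes_inv_o(2)[OF H_group_permutes[OF h]] by (simp add: comp_assoc)
  then show "g \<in> (\<lambda>g. g \<circ> h) ` H_group l k"
    using H_group_comp[OF g H_group_inv[OF h]] by blast
qed (auto intro: H_group_comp[OF _ h])

lemma orbit_mor_act:
  assumes "h \<in> H_group l k"
  shows "orbit_mor l k d (act_mor d h m) = orbit_mor l k d m"
proof -
  have "orbit_mor l k d (act_mor d h m) = (\<lambda>g. act_mor d g m) ` (\<lambda>g. g \<circ> h) ` H_group l k"
    by (simp add: orbit_mor_def act_mor_comp image_image)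
  then show ?thesis by (simp add: H_group_right_translation[OF assms] orbit_mor_def)
qed

lemma orbit_mor_eqD:
  assumes "m' \<in> Mor (G_groupoid l d)" "orbit_mor l k d m = orbit_mor l k d m'"
  obtains h where "h \<in> H_group l k" "m' = act_mor d h m"
  using orbit_mor_self[OF assms(1)] assms(2) unfolding orbit_mor_def by auto

lemma quotient_groupoid_simps:
  "Obj (quotient_groupoid l k d) = orbit_obj l k d ` G_objs l d"
  "Mor (quotient_groupoid l k d) = orbit_mor l k d ` Mor (G_groupoid l d)"
  "Idm (quotient_groupoid l k d) F = Idm (G_groupoid l d) ` F"
  by (simp_all add: quotient_groupoid_def Let_def) (simp add: G_groupoid_def)

lemma quotient_Src: "Src (quotient_groupoid l k d) (orbit_mor l k d m) = orbit_obj l k d (Src (G_groupoid l d) m)"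
  and quotient_Tgt: "Tgt (quotient_groupoid l k d) (orbit_mor l k d m) = orbit_obj l k d (Tgt (G_groupoid l d) m)"
  and quotient_Idm: "Idm (quotient_groupoid l k d) (orbit_obj l k d f) = orbit_mor l k d (Idm (G_groupoid l d) f)"
  unfolding quotient_groupoid_def Let_def orbit_mor_def orbit_obj_def groupoid.simps image_image
  by (simp_all only: act_mor_Src act_mor_Tgt act_mor_Idm)

text \<open>If translates of \<open>p\<close> and \<open>q\<close> are composable, freeness at the
  object where they meet forces both translations to be by the same \<open>h\<close>. All composites
  of representatives therefore lie in one orbit, and the definite description is justified.\<close>

lemma quotient_Cmp:
  assumes p: "p \<in> Mor (G_groupoid l d)" and q: "q \<in> Mor (G_groupoid l d)"
    and pq: "Src (G_groupoid l d) p = Tgt (G_groupoid l d) q"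
  shows "Cmp (quotient_groupoid l k d) (orbit_mor l k d p) (orbit_mor l k d q) =
    orbit_mor l k d (Cmp (G_groupoid l d) p q)"
proof -
  let ?C = "G_groupoid l d"
  have "(THE R. \<exists>\<tau>\<in>orbit_mor l k d p. \<exists>\<sigma>\<in>orbit_mor l k d q.
      Src ?C \<tau> = Tgt ?C \<sigma> \<and> R = orbit_mor l k d (Cmp ?C \<tau> \<sigma>)) = orbit_mor l k d (Cmp ?C p q)"
  proof (rule the_equality)
    show "\<exists>\<tau>\<in>orbit_mor l k d p. \<exists>\<sigma>\<in>orbit_mor l k d q.
        Src ?C \<tau> = Tgt ?C \<sigma> \<and> orbit_mor l k d (Cmp ?C p q) = orbit_mor l k d (Cmp ?C \<tau> \<sigma>)"
      using orbit_mor_self[OF p] orbit_mor_self[OF q] pq by blast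
    fix R assume "\<exists>\<tau>\<in>orbit_mor l k d p. \<exists>\<sigma>\<in>orbit_mor l k d q.
        Src ?C \<tau> = Tgt ?C \<sigma> \<and> R = orbit_mor l k d (Cmp ?C \<tau> \<sigma>)"
    then obtain h h' where h: "h \<in> H_group l k" "h' \<in> H_group l k"
      and eq: "Src ?C (act_mor d h p) = Tgt ?C (act_mor d h' q)"
      and R: "R = orbit_mor l k d (Cmp ?C (act_mor d h p) (act_mor d h' q))"
      unfolding orbit_mor_def by blast
    have "h = h'"
      using act_obj_free[OF G_groupoid_Src_in[OF p] h] eq pq by (simp add: act_mor_Src act_mor_Tgt)
    then show "R = orbit_mor l k d (Cmp ?C p q)"
      unfolding R using orbit_mor_act[OF h(2)] by (simp add: act_mor_Cmp)
  qed
  then show ?thesis by (simp add: quotient_groupoid_def Let_def)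
qed

lemma finite_G_groupoid_Mor: "finite (Mor (G_groupoid l d))"
  by (rule finite_subset[of _ "G_objs l d \<times> {\<sigma>. \<sigma> permutes {1..d}} \<times> G_objs l d"])
    (auto simp: G_groupoid_def finite_permutations)

section \<open>The map Psi and its image\<close>

lemma A_quot_alg_carrier:
  "carrier (A_quot_alg l k d) = {u. \<forall>T. T \<notin> Mor (quotient_groupoid l k d) \<longrightarrow> u T = 0}"
  by (simp add: A_quot_alg_def groupoid_algebra_def basis_algebra_def)

lemma groupoid_algebra_mult:
  "(u \<otimes>\<^bsub>groupoid_algebra C\<^esub> v) m =
    (\<Sum>(p, q) \<in> {(p, q). p \<in> Mor C \<and> q \<in> Mor C \<and> Src C p = Tgt C q \<and> Cmp C p q = m}. u p * v q)"
  unfolding groupoid_algebra_def basis_algebra_def monoid.simps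
  by (rule sum.cong) (auto split: if_splits)

text \<open>A morphism lies in exactly one orbit, so a single summand survives: \<open>Psi\<close>
  is pullback along the orbit map. Its further properties are read off from this form.\<close>

lemma Psi_apply:
  "Psi l k d u m = (if m \<in> Mor (G_groupoid l d) then u (orbit_mor l k d m) else 0)"
proof -
  let ?X = "Mor (G_groupoid l d)"
  have "u T * (\<Sum>\<tau>\<in>T. basis_elt \<tau> m) =
      (if T = orbit_mor l k d m then if m \<in> ?X then u (orbit_mor l k d m) else 0 else 0)"
    if T: "T \<in> orbit_mor l k d ` ?X" for T
  proof -
    obtain n where n: "n \<in> ?X" "T = orbit_mor l k d n" using T by blast
    have "finite T" unfolding n(2) orbit_mor_def by (simp add: finite_H_group)
    then have "(\<Sum>\<tau>\<in>T. basis_elt \<tau> m) = (if m \<in> T then 1 else 0)" by (simp add: basis_elt_def)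
    moreover have "m \<in> T \<longleftrightarrow> T = orbit_mor l k d m \<and> m \<in> ?X"
    proof
      assume "m \<in> T"
      then obtain h where "h \<in> H_group l k" "m = act_mor d h n" unfolding n(2) orbit_mor_def by blast
      then show "T = orbit_mor l k d m \<and> m \<in> ?X" using n act_mor_in orbit_mor_act by metis
    qed (auto intro: orbit_mor_self)
    ultimately show ?thesis by simp
  qed
  then have "Psi l k d u m = (\<Sum>T\<in>orbit_mor l k d ` ?X.
      if T = orbit_mor l k d m then if m \<in> ?X then u (orbit_mor l k d m) else 0 else 0)"
    unfolding Psi_def quotient_groupoid_simps by (rule sum.cong[OF refl])
  then show ?thesis by (simp add: finite_G_groupoid_Mor)
qed

definition H_invariants :: "(mor \<Rightarrow> complex) set" where
  "H_invariants = {b \<in> carrier (A_alg l d).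
    \<forall>h\<in>H_group l k. \<forall>m\<in>Mor (G_groupoid l d). b (act_mor d h m) = b m}"

lemma Psi_image: "Psi l k d ` carrier (A_quot_alg l k d) = H_invariants"
proof (intro equalityI subsetI)
  fix b assume "b \<in> Psi l k d ` carrier (A_quot_alg l k d)"
  then show "b \<in> H_invariants"
    by (auto simp: H_invariants_def A_alg_carrier Psi_apply act_mor_in orbit_mor_act)
next
  fix b assume b: "b \<in> H_invariants"
  \<comment> \<open>The chosen representative does not matter, because \<open>b\<close> is constant
    on orbits.\<close>
  define u where "u T = (if T \<in> Mor (quotient_groupoid l k d) then b (SOME m. m \<in> T) else 0)" for T
  have "Psi l k d u m = b m" for m
  proof (cases "m \<in> Mor (G_groupoid l d)")
    case True
    have "(SOME n. n \<in> orbit_mor l k d m) \<in> orbit_mor l k d m"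
      using orbit_mor_self[OF True] by (rule someI)
    then obtain h where "h \<in> H_group l k" "(SOME n. n \<in> orbit_mor l k d m) = act_mor d h m"
      unfolding orbit_mor_def by blast
    then have "b (SOME n. n \<in> orbit_mor l k d m) = b m" using b True by (simp add: H_invariants_def)
    then show ?thesis using True by (simp add: Psi_apply u_def quotient_groupoid_simps)
  next
    case False
    moreover have "b m = 0" using False b unfolding H_invariants_def A_alg_carrier by blast
    ultimately show ?thesis by (simp add: Psi_apply)
  qed
  moreover have "u \<in> carrier (A_quot_alg l k d)" by (simp add: A_quot_alg_carrier u_def)
  ultimately show "b \<in> Psi l k d ` carrier (A_quot_alg l k d)" by (intro image_eqI[of _ _ u]) auto
qed

lemma Psi_inj: "inj_on (Psi l k d) (carrier (A_quot_alg l k d))"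
proof (rule inj_onI)
  fix u v assume u: "u \<in> carrier (A_quot_alg l k d)" and v: "v \<in> carrier (A_quot_alg l k d)"
    and eq: "Psi l k d u = Psi l k d v"
  show "u = v"
  proof
    fix T
    show "u T = v T"
    proof (cases "T \<in> Mor (quotient_groupoid l k d)")
      case True
      then obtain m where "m \<in> Mor (G_groupoid l d)" "T = orbit_mor l k d m"
        by (auto simp: quotient_groupoid_simps)
      then show ?thesis using fun_cong[OF eq, of m] by (simp add: Psi_apply)
    next
      case False
      then show ?thesis using u v by (simp add: A_quot_alg_carrier)
    qed
  qed
qed

text \<open>Since the composite is \<open>m\<close>, two lifts of a factorization agree in the
  target of the left factor and the source of the right one, and freeness at these outer ends
  identifies them. Existence takes two translations: one of the left factor to make the pair
  composable, then a common one to turn the composite into \<open>m\<close> itself.\<close>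

lemma orbit_factorizations:
  assumes m: "m \<in> Mor (G_groupoid l d)"
  shows "bij_betw (\<lambda>(p, q). (orbit_mor l k d p, orbit_mor l k d q))
    {(p, q). p \<in> Mor (G_groupoid l d) \<and> q \<in> Mor (G_groupoid l d) \<and>
      Src (G_groupoid l d) p = Tgt (G_groupoid l d) q \<and> Cmp (G_groupoid l d) p q = m}
    {(T, S). T \<in> Mor (quotient_groupoid l k d) \<and> S \<in> Mor (quotient_groupoid l k d) \<and>
      Src (quotient_groupoid l k d) T = Tgt (quotient_groupoid l k d) S \<and>
      Cmp (quotient_groupoid l k d) T S = orbit_mor l k d m}" (is "bij_betw ?o ?F ?F'")
proof (rule bij_betw_imageI)
  let ?C = "G_groupoid l d"
  show "inj_on ?o ?F"
  proof (rule inj_onI)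
    fix x y assume x: "x \<in> ?F" and y: "y \<in> ?F" and eq: "?o x = ?o y"
    obtain p q where pq: "x = (p, q)" by (cases x)
    obtain p' q' where pq': "y = (p', q')" by (cases y)
    have mem: "p \<in> Mor ?C" "q \<in> Mor ?C" "p' \<in> Mor ?C" "q' \<in> Mor ?C" and comp: "Cmp ?C p q = m" "Cmp ?C p' q' = m"
      using x y pq pq' by auto
    obtain h where h: "h \<in> H_group l k" "p' = act_mor d h p"
      using orbit_mor_eqD[OF mem(3), of p] eq pq pq' by auto
    obtain h' where h': "h' \<in> H_group l k" "q' = act_mor d h' q"
      using orbit_mor_eqD[OF mem(4), of q] eq pq pq' by auto
    have "Tgt ?C p' = Tgt ?C p" "Src ?C q' = Src ?C q"
      using comp G_groupoid_Tgt_Cmp G_groupoid_Src_Cmp by metis+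
    then have "p' = p" "q' = q"
      using act_mor_free_Tgt[OF mem(1) h(1)] act_mor_free_Src[OF mem(2) h'(1)] h h' by auto
    then show "x = y" using pq pq' by simp
  qed
  show "?o ` ?F = ?F'"
  proof (intro equalityI subsetI)
    fix z assume "z \<in> ?o ` ?F"
    then show "z \<in> ?F'"
      using d_pos by (auto simp: quotient_groupoid_simps(2) quotient_Src quotient_Tgt quotient_Cmp)
  next
    fix z assume z: "z \<in> ?F'"
    then obtain p0 q where pq: "p0 \<in> Mor ?C" "q \<in> Mor ?C" "z = (orbit_mor l k d p0, orbit_mor l k d q)"
      by (auto simp: quotient_groupoid_simps(2))
    have "orbit_obj l k d (Src ?C p0) = orbit_obj l k d (Tgt ?C q)"
      using z pq by (simp add: quotient_Src quotient_Tgt)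
    then have "Tgt ?C q \<in> orbit_obj l k d (Src ?C p0)"
      using orbit_obj_self[OF G_groupoid_Tgt_in[OF pq(2)]] by simp
    then obtain h where h: "h \<in> H_group l k" "Tgt ?C q = act_obj d h (Src ?C p0)"
      unfolding orbit_obj_def by blast
    \<comment> \<open>The representative of the left orbit that starts where \<open>q\<close>
      ends.\<close>
    define p where "p = act_mor d h p0"
    have p: "p \<in> Mor ?C" "Src ?C p = Tgt ?C q" "orbit_mor l k d p = orbit_mor l k d p0"
      using act_mor_in[OF h(1) pq(1)] h(2) orbit_mor_act[OF h(1)] by (auto simp: p_def act_mor_Src)
    have "orbit_mor l k d (Cmp ?C p q) = orbit_mor l k d m"
      using z pq(3) quotient_Cmp[OF p(1) pq(2) p(2)] p(3) by simp
    then obtain g where g: "g \<in> H_group l k" "m = act_mor d g (Cmp ?C p q)"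
      by (rule orbit_mor_eqD[OF m])
    have "(act_mor d g p, act_mor d g q) \<in> ?F"
      using g p pq(2) act_mor_in[OF g(1)] by (simp add: act_mor_Src act_mor_Tgt act_mor_Cmp)
    moreover have "z = ?o (act_mor d g p, act_mor d g q)"
      using pq(3) p(3) orbit_mor_act[OF g(1)] by simp
    ultimately show "z \<in> ?o ` ?F" by (rule rev_image_eqI)
  qed
qed

text \<open>The coefficient at \<open>m\<close> sums over factorizations of its orbit, which the
  preceding bijection turns into factorizations of \<open>m\<close>.\<close>

lemma Psi_mult:
  shows "Psi l k d (u \<otimes>\<^bsub>A_quot_alg l k d\<^esub> v) = Psi l k d u \<otimes>\<^bsub>A_alg l d\<^esub> Psi l k d v"
proof
  fix m
  let ?C = "G_groupoid l d"
  let ?F = "{(p, q). p \<in> Mor ?C \<and> q \<in> Mor ?C \<and> Src ?C p = Tgt ?C q \<and> Cmp ?C p q = m}"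
  show "Psi l k d (u \<otimes>\<^bsub>A_quot_alg l k d\<^esub> v) m = (Psi l k d u \<otimes>\<^bsub>A_alg l d\<^esub> Psi l k d v) m"
  proof (cases "m \<in> Mor ?C")
    case True
    have "Psi l k d (u \<otimes>\<^bsub>A_quot_alg l k d\<^esub> v) m =
        (\<Sum>(p, q) \<in> ?F. u (orbit_mor l k d p) * v (orbit_mor l k d q))"
      unfolding Psi_apply A_quot_alg_def groupoid_algebra_mult
        sum.reindex_bij_betw[OF orbit_factorizations[OF True], symmetric]
      using True by (simp add: split_def)
    also have "\<dots> = (\<Sum>(p, q) \<in> ?F. Psi l k d u p * Psi l k d v q)"
      by (rule sum.cong) (auto simp: Psi_apply)
    also have "\<dots> = (Psi l k d u \<otimes>\<^bsub>A_alg l d\<^esub> Psi l k d v) m"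
      by (simp add: A_alg_def groupoid_algebra_mult)
    finally show ?thesis .
  next
    case False
    then have "(Psi l k d u \<otimes>\<^bsub>A_alg l d\<^esub> Psi l k d v) m = 0"
      using A_alg_mult_closed[of l d "Psi l k d u" "Psi l k d v"] unfolding A_alg_carrier by blast
    then show ?thesis using False by (simp add: Psi_apply)
  qed
qed

text \<open>The action permutes the identities, so a morphism whose orbit is that of an identity is
  itself an identity.\<close>

lemma Psi_one: "Psi l k d \<one>\<^bsub>A_quot_alg l k d\<^esub> = \<one>\<^bsub>A_alg l d\<^esub>"
proof
  fix m
  let ?C = "G_groupoid l d"
  have "m \<in> Mor ?C \<and> orbit_mor l k d m \<in> Idm (quotient_groupoid l k d) ` Obj (quotient_groupoid l k d) \<longleftrightarrow>
      m \<in> Idm ?C ` Obj ?C" (is "?L \<longleftrightarrow> ?R")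
  proof
    assume ?L
    then obtain f where f: "f \<in> G_objs l d" and m: "m \<in> Mor ?C"
      and eq: "orbit_mor l k d m = orbit_mor l k d (Idm ?C f)"
      by (auto simp: quotient_groupoid_simps(1) quotient_Idm simp del: G_groupoid_simps(4))
    obtain h where "h \<in> H_group l k" "m = act_mor d h (Idm ?C f)"
      using eq[symmetric] by (rule orbit_mor_eqD[OF m])
    then show ?R using act_obj_in[OF _ f] by (auto simp: act_mor_Idm simp del: G_groupoid_simps(4))
  next
    assume ?R
    then obtain f where f: "f \<in> G_objs l d" "m = Idm ?C f" by auto
    then have "m \<in> Mor ?C" by (simp add: G_groupoid_Mor_iff)
    moreover have "orbit_mor l k d m = Idm (quotient_groupoid l k d) (orbit_obj l k d f)"
      unfolding f(2) by (rule quotient_Idm[symmetric])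
    ultimately show ?L using f(1) by (auto simp: quotient_groupoid_simps(1))
  qed
  then show "Psi l k d \<one>\<^bsub>A_quot_alg l k d\<^esub> m = \<one>\<^bsub>A_alg l d\<^esub> m"
    by (auto simp: Psi_apply A_quot_alg_def A_alg_def groupoid_algebra_def basis_algebra_def simp del: G_groupoid_simps)
qed

lemma Psi_add: "Psi l k d (u \<oplus>\<^bsub>A_quot_alg l k d\<^esub> v) = Psi l k d u \<oplus>\<^bsub>A_alg l d\<^esub> Psi l k d v"
  and Psi_smult: "Psi l k d (c \<odot>\<^bsub>A_quot_alg l k d\<^esub> u) = c \<odot>\<^bsub>A_alg l d\<^esub> Psi l k d u"
  by (auto simp: fun_eq_iff Psi_apply A_quot_alg_def A_alg_def groupoid_algebra_def basis_algebra_def)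

end

section \<open>Invariants and the complex reflection group\<close>

lemma group_algebra_G_carrier:
  "carrier (group_algebra (G_group l k d)) = {a \<in> carrier (group_algebra (S_group l d)).
    \<forall>M\<in>carrier (S_group l d). a M \<noteq> 0 \<longrightarrow> nonzero_entries_prod d M ^ (l div k) = 1}"
  by (auto simp: group_algebra_def basis_algebra_def G_group_def roots_of_1_def)

lemma group_algebra_G_simps:
  "\<one>\<^bsub>group_algebra (G_group l k d)\<^esub> = \<one>\<^bsub>group_algebra (S_group l d)\<^esub>"
  "a \<oplus>\<^bsub>group_algebra (G_group l k d)\<^esub> b = a \<oplus>\<^bsub>group_algebra (S_group l d)\<^esub> b"
  "c \<odot>\<^bsub>group_algebra (G_group l k d)\<^esub> a = c \<odot>\<^bsub>group_algebra (S_group l d)\<^esub> a"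
  by (simp_all add: group_algebra_def basis_algebra_def G_group_def)

text \<open>The additional factorizations in the larger group contribute 0, because both coefficient
  functions are supported on the subgroup.\<close>

lemma group_algebra_G_mult:
  assumes "l > 0" and a: "a \<in> carrier (group_algebra (G_group l k d))"
    and b: "b \<in> carrier (group_algebra (G_group l k d))"
  shows "a \<otimes>\<^bsub>group_algebra (G_group l k d)\<^esub> b = a \<otimes>\<^bsub>group_algebra (S_group l d)\<^esub> b"
proof
  fix x
  let ?S = "carrier (S_group l d)" and ?G = "carrier (G_group l k d)"
  have "?G \<subseteq> ?S" by (auto simp: G_group_def)
  have supp: "p \<in> ?G" if "a p \<noteq> 0 \<or> b p \<noteq> 0" for p
    using a b that by (auto simp: group_algebra_def basis_algebra_def)
  have fin: "finite {(p, q). p \<in> ?S \<and> q \<in> ?S \<and> p * q = x}"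
    by (rule finite_subset[of _ "?S \<times> ?S"]) (auto simp: finite_S_group[OF assms(1)])
  have "(a \<otimes>\<^bsub>group_algebra (G_group l k d)\<^esub> b) x =
      (\<Sum>(p, q) \<in> {(p, q). p \<in> ?G \<and> q \<in> ?G \<and> p * q = x}. a p * b q)"
    by (simp add: group_algebra_def basis_algebra_def G_group_def)
  also have "\<dots> = (\<Sum>(p, q) \<in> {(p, q). p \<in> ?S \<and> q \<in> ?S \<and> p * q = x}. a p * b q)"
    using \<open>?G \<subseteq> ?S\<close> fin by (intro sum.mono_neutral_left) (auto intro: supp)
  finally show "(a \<otimes>\<^bsub>group_algebra (G_group l k d)\<^esub> b) x = (a \<otimes>\<^bsub>group_algebra (S_group l d)\<^esub> b) x"
    by (simp add: group_algebra_S_mult)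
qed

locale wreath_quotient = root_generator l xi + cyclic_action l k d
  for l k d :: nat and xi :: complex
begin

lemma nonzero_entries_prod_powers_mat:
  assumes "\<sigma> permutes {1..d}"
  shows "nonzero_entries_prod d (powers_mat d \<sigma> e) = (\<Prod>j\<in>{1..d}. xi ^ e j)"
  using assms by (intro nonzero_entries_prod_mono_mat) auto

text \<open>The kernel depends on its argument only modulo \<open>l\<close>, so \<open>h\<close> may
  be replaced by adding \<open>c\<close>. The correction factor does not involve
  \<open>f\<close>.\<close>

lemma kern_act_obj:
  assumes f: "f \<in> G_objs l d" and c: "\<forall>x\<in>{1..l}. h x mod l = (x + c) mod l"
  shows "kern d e (act_obj d h f) = kern d e f * (\<Prod>j\<in>{1..d}. xi ^ e j) ^ c"
proof -
  have "xi ^ (e j * act_obj d h f j) = xi ^ (e j * f j) * (xi ^ e j) ^ c" if j: "j \<in> {1..d}" for j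
  proof -
    have "act_obj d h f j = h (f j)" using j by (simp add: act_obj_def compose_def)
    then have "(e j * act_obj d h f j) mod l = (e j * (f j + c)) mod l"
      using bspec[OF c G_objs_range(1)[OF f j]] by (metis mod_mult_right_eq)
    then have "xi ^ (e j * act_obj d h f j) = xi ^ (e j * (f j + c))" by (rule generator_power_mod)
    then show ?thesis by (simp add: distrib_left power_add power_mult)
  qed
  then show ?thesis unfolding kern_def prod_power_distrib prod.distrib[symmetric] by (intro prod.cong refl)
qed

text \<open>Fourier duality: a translation of the argument is multiplication of the coefficients by
  a character, here a power of the product of the non-zero entries. It is the same function of
  \<open>M\<close> for every morphism \<open>m\<close>.\<close>

lemma fourier_act_mor:
  assumes a: "a \<in> carrier (group_algebra (S_group l d))"
    and h: "h \<in> H_group l k" and c: "\<forall>x\<in>{1..l}. h x mod l = (x + c) mod l"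
    and m: "m \<in> Mor (G_groupoid l d)"
  shows "fourier l d a (act_mor d h m) = fourier l d (\<lambda>M. a M * nonzero_entries_prod d M ^ c) m"
proof -
  obtain f \<sigma> where m_eq: "m = (f, \<sigma>, f \<circ> inv' \<sigma>)" and f: "f \<in> G_objs l d" and \<sigma>: "\<sigma> permutes {1..d}"
    using m by (metis G_groupoid_Mor_iff prod.exhaust)
  have hf: "act_obj d h f \<in> G_objs l d" by (rule act_obj_in[OF h f])
  have act: "act_mor d h m = (act_obj d h f, \<sigma>, act_obj d h f \<circ> inv' \<sigma>)"
    using act_mor_in[OF h m] unfolding m_eq act_mor_def by (simp add: G_groupoid_Mor_iff)
  have ap: "(\<lambda>M. a M * nonzero_entries_prod d M ^ c) \<in> carrier (group_algebra (S_group l d))"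
    using a by (simp add: group_algebra_S_carrier)
  show ?thesis
    unfolding m_eq act[unfolded m_eq] fourier_powers_mat[OF a \<sigma> hf] fourier_powers_mat[OF ap \<sigma> f]
    by (intro sum.cong refl) (simp add: kern_act_obj[OF f c] nonzero_entries_prod_powers_mat[OF \<sigma>])
qed

text \<open>Support in \<open>G_group\<close> gives invariance under all of \<open>H_group\<close>,
  since every step size is a multiple of \<open>l div k\<close>. Conversely, invariance under the
  generator alone already restricts the support.\<close>

lemma fourier_group_algebra_G:
  "fourier l d ` carrier (group_algebra (G_group l k d)) = H_invariants"
proof (intro equalityI subsetI)
  fix b assume "b \<in> fourier l d ` carrier (group_algebra (G_group l k d))"
  then obtain a where b: "b = fourier l d a" and a_S: "a \<in> carrier (group_algebra (S_group l d))"
    and a_G: "\<And>M. M \<in> carrier (S_group l d) \<Longrightarrow> a M \<noteq> 0 \<Longrightarrow> nonzero_entries_prod d M ^ (l div k) = 1"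
    by (auto simp: group_algebra_G_carrier)
  have "b (act_mor d h m) = b m" if h: "h \<in> H_group l k" and m: "m \<in> Mor (G_groupoid l d)" for h m
  proof -
    obtain c where c: "(l div k) dvd c" "\<forall>x\<in>{1..l}. h x mod l = (x + c) mod l"
      by (rule H_group_shift[OF h]) blast
    \<comment> \<open>On the support of \<open>a\<close> the power with exponent
      \<open>l div k\<close> is 1, hence so is the one with its multiple \<open>c\<close>.\<close>
    have "(\<lambda>M. a M * nonzero_entries_prod d M ^ c) = a"
    proof
      fix M
      show "a M * nonzero_entries_prod d M ^ c = a M"
      proof (cases "M \<in> carrier (S_group l d) \<and> a M \<noteq> 0")
        case True
        then show ?thesis using a_G[of M] c(1) by (auto simp: power_mult elim!: dvdE)
      next
        case False
        then show ?thesis using a_S by (auto simp: group_algebra_S_carrier)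
      qed
    qed
    then show ?thesis unfolding b fourier_act_mor[OF a_S h c(2) m] by simp
  qed
  moreover have "b \<in> carrier (A_alg l d)"
    using bij_betwE[OF fourier_bij] a_S b by blast
  ultimately show "b \<in> H_invariants" by (simp add: H_invariants_def)
next
  fix b assume b: "b \<in> H_invariants"
  then obtain a where a: "a \<in> carrier (group_algebra (S_group l d))" "b = fourier l d a"
    unfolding H_invariants_def bij_betw_imp_surj_on[OF fourier_bij, symmetric] by auto
  \<comment> \<open>The coefficients of the translate of \<open>b\<close> by the generator of
    \<open>H_group\<close>. Invariance of \<open>b\<close> equates the transforms of
    \<open>a'\<close> and \<open>a\<close>, and injectivity equates the coefficients.\<close>
  define a' where "a' M = a M * nonzero_entries_prod d M ^ (l div k)" for M
  have a': "a' \<in> carrier (group_algebra (S_group l d))"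
    using a(1) by (simp add: group_algebra_S_carrier a'_def)
  have "fourier l d a' m = fourier l d a m" for m
  proof (cases "m \<in> Mor (G_groupoid l d)")
    case True
    have shift: "\<forall>x\<in>{1..l}. (theta l ^^ (l div k)) x mod l = (x + l div k) mod l"
      using theta_pow_shift by blast
    have "fourier l d a' m = b (act_mor d (theta l ^^ (l div k)) m)"
      unfolding a(2) a'_def
      using fourier_act_mor[OF a(1) theta_pow_in_H_group shift True] by simp
    also have "\<dots> = b m" using b True theta_pow_in_H_group by (simp add: H_invariants_def)
    finally show ?thesis by (simp add: a(2))
  next
    case False
    then show ?thesis using a(1) a' by (simp add: fourier_apply)
  qed
  then have "a' = a"
    using inj_onD[OF bij_betw_imp_inj_on[OF fourier_bij] _ a' a(1)] by blast
  then have "a M * nonzero_entries_prod d M ^ (l div k) = a M" for M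
    using a'_def by metis
  \<comment> \<open>Where \<open>a M\<close> is non-zero it cancels, which leaves the defining
    condition of \<open>G_group\<close>.\<close>
  then have "a \<in> carrier (group_algebra (G_group l k d))"
    using a(1) by (auto simp: group_algebra_G_carrier)
  then show "b \<in> fourier l d ` carrier (group_algebra (G_group l k d))" using a(2) by blast
qed

section \<open>Transport of the algebra structure\<close>

lemma group_algebra_S_one_closed:
  "\<one>\<^bsub>group_algebra (S_group l d)\<^esub> \<in> carrier (group_algebra (S_group l d))"
  using S_group_one[OF l_pos] by (auto simp: group_algebra_def basis_algebra_def)

lemma group_algebra_S_ops_closed:
  assumes "a \<in> carrier (group_algebra (S_group l d))" "b \<in> carrier (group_algebra (S_group l d))"
  shows "a \<oplus>\<^bsub>group_algebra (S_group l d)\<^esub> b \<in> carrier (group_algebra (S_group l d))"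
    and "c \<odot>\<^bsub>group_algebra (S_group l d)\<^esub> a \<in> carrier (group_algebra (S_group l d))"
  using assms by (auto simp: group_algebra_def basis_algebra_def)

definition Phi_inv_Psi :: "(mor set \<Rightarrow> complex) \<Rightarrow> complex mat \<Rightarrow> complex" where
  "Phi_inv_Psi = inv_into (carrier (group_algebra (S_group l d))) (fourier l d) \<circ> Psi l k d"

lemma Phi_inv_Psi_bij:
  "bij_betw Phi_inv_Psi (carrier (A_quot_alg l k d)) (carrier (group_algebra (G_group l k d)))"
  unfolding Phi_inv_Psi_def
proof (rule bij_betw_trans)
  show "bij_betw (Psi l k d) (carrier (A_quot_alg l k d)) H_invariants"
    by (simp add: bij_betw_def Psi_inj Psi_image)
  show "bij_betw (inv_into (carrier (group_algebra (S_group l d))) (fourier l d))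
      H_invariants (carrier (group_algebra (G_group l k d)))"
    by (rule bij_betw_inv_into_subset[OF fourier_bij _ fourier_group_algebra_G])
      (auto simp: group_algebra_G_carrier)
qed

text \<open>By injectivity of \<open>fourier\<close>, an equation for \<open>Phi_inv_Psi\<close> can
  be checked after transforming, where no inverse occurs any more.\<close>

lemma Phi_inv_Psi_eqI:
  assumes "x \<in> carrier (group_algebra (S_group l d))" "fourier l d x = Psi l k d u"
  shows "Phi_inv_Psi u = x"
  using inv_into_f_f[OF bij_betw_imp_inj_on[OF fourier_bij] assms(1)] assms(2)
  by (simp add: Phi_inv_Psi_def)

lemma fourier_Phi_inv_Psi:
  assumes "u \<in> carrier (A_quot_alg l k d)"
  shows "fourier l d (Phi_inv_Psi u) = Psi l k d u"
proof -
  have "Psi l k d u \<in> carrier (A_alg l d)"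
    using Psi_image assms by (auto simp: H_invariants_def)
  then show ?thesis
    using bij_betw_inv_into_right[OF fourier_bij] by (simp add: Phi_inv_Psi_def)
qed

text \<open>Both sides of each law have the same transform, since \<open>fourier\<close> and
  \<open>Psi\<close> respect the operations. The operations of the two group algebras agree on
  elements supported on \<open>G_group\<close>.\<close>

lemma Phi_inv_Psi_iso: "Phi_inv_Psi \<in> algebra_iso (A_quot_alg l k d) (group_algebra (G_group l k d))"
proof -
  let ?Q = "A_quot_alg l k d" and ?S = "group_algebra (S_group l d)" and ?G = "group_algebra (G_group l k d)"
  have hom: "\<And>x y. x \<in> carrier ?S \<Longrightarrow> y \<in> carrier ?S \<Longrightarrow>
      fourier l d (x \<otimes>\<^bsub>?S\<^esub> y) = fourier l d x \<otimes>\<^bsub>A_alg l d\<^esub> fourier l d y"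
    "\<And>x y. x \<in> carrier ?S \<Longrightarrow> y \<in> carrier ?S \<Longrightarrow>
      fourier l d (x \<oplus>\<^bsub>?S\<^esub> y) = fourier l d x \<oplus>\<^bsub>A_alg l d\<^esub> fourier l d y"
    "\<And>c x. x \<in> carrier ?S \<Longrightarrow> fourier l d (c \<odot>\<^bsub>?S\<^esub> x) = c \<odot>\<^bsub>A_alg l d\<^esub> fourier l d x"
    "fourier l d \<one>\<^bsub>?S\<^esub> = \<one>\<^bsub>A_alg l d\<^esub>"
    using fourier_algebra_hom[OF l_pos, of d] by (auto simp: algebra_hom_def ring_hom_def)
  have G: "Phi_inv_Psi u \<in> carrier ?G" if "u \<in> carrier ?Q" for u
    using bij_betwE[OF Phi_inv_Psi_bij] that by blast
  then have S: "Phi_inv_Psi u \<in> carrier ?S" if "u \<in> carrier ?Q" for u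
    using that by (simp add: group_algebra_G_carrier)
  have "Phi_inv_Psi (u \<otimes>\<^bsub>?Q\<^esub> v) = Phi_inv_Psi u \<otimes>\<^bsub>?G\<^esub> Phi_inv_Psi v"
    if "u \<in> carrier ?Q" "v \<in> carrier ?Q" for u v
    unfolding group_algebra_G_mult[OF l_pos G[OF that(1)] G[OF that(2)]]
    using that S by (intro Phi_inv_Psi_eqI group_algebra_S_mult_closed[OF l_pos])
      (simp add: hom Psi_mult fourier_Phi_inv_Psi)
  moreover have "Phi_inv_Psi (u \<oplus>\<^bsub>?Q\<^esub> v) = Phi_inv_Psi u \<oplus>\<^bsub>?G\<^esub> Phi_inv_Psi v"
    if "u \<in> carrier ?Q" "v \<in> carrier ?Q" for u v
    unfolding group_algebra_G_simps
    using that S by (intro Phi_inv_Psi_eqI group_algebra_S_ops_closed)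
      (simp_all add: hom Psi_add fourier_Phi_inv_Psi)
  moreover have "Phi_inv_Psi (c \<odot>\<^bsub>?Q\<^esub> u) = c \<odot>\<^bsub>?G\<^esub> Phi_inv_Psi u" if "u \<in> carrier ?Q" for c u
    unfolding group_algebra_G_simps
    using that S by (intro Phi_inv_Psi_eqI group_algebra_S_ops_closed)
      (simp_all add: hom Psi_smult fourier_Phi_inv_Psi)
  moreover have "Phi_inv_Psi \<one>\<^bsub>?Q\<^esub> = \<one>\<^bsub>?G\<^esub>"
    unfolding group_algebra_G_simps
    by (intro Phi_inv_Psi_eqI group_algebra_S_one_closed) (simp add: hom Psi_one)
  ultimately show ?thesis
    using G Phi_inv_Psi_bij by (simp add: algebra_iso_def algebra_hom_def ring_hom_def)
qed

end

theorem theorem16: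
  fixes l k d :: nat and xi :: complex
  assumes "l > 0" and "k > 0" and "d > 0" and "k dvd l"
    and "is_generator_of_roots l xi"
  shows "(inv_into (carrier (group_algebra (S_group l d))) (Phi l d xi) \<circ> Psi l k d)
           ` carrier (A_quot_alg l k d) = carrier (group_algebra (G_group l k d))
         \<and> algebras_isomorphic (A_quot_alg l k d) (group_algebra (G_group l k d))"
proof -
  interpret wreath_quotient l k d xi
    using assms by unfold_locales auto
  have "Phi_inv_Psi = inv_into (carrier (group_algebra (S_group l d))) (Phi l d xi) \<circ> Psi l k d"
    by (simp add: Phi_inv_Psi_def Phi_eq_fourier[OF \<open>d > 0\<close>])
  then show ?thesis
    using bij_betw_imp_surj_on[OF Phi_inv_Psi_bij] Phi_inv_Psi_iso
    by (auto simp: algebras_isomorphic_def)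
qed

end
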